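(* Let $p\ge2$ and $c\ge3$ be integers, and define $$\eta(p,c)=\begin{cases}\min\{2p,c\},&c\text{ is even},\\ c-1,&c\text{ is odd},\ p\text{ is even},\text{ and }p\ge c,\\ \min\{p,c\},&\text{otherwise}.\end{cases}$$ Then $$M_-(P_p\square C_c)=\eta(p,c)\qquad\text{and}\qquad \operatorname{mr}^-(P_p\square C_c)=pc-\eta(p,c).$$ Moreover, if $c$ is odd, $p$ is even, and $p\ge c$, then $$M_-(P_p\square C_c)=c-1<c=Z_-(P_p\square C_c)\qquad\text{and}\qquad M_0(P_p\square C_c)=c.$$
   Context: All graphs are finite and simple. $P_n$ and $C_n$ are the path and the cycle on $n$ vertices. The Cartesian product $G\square H$ has vertex set $V(G)\times V(H)$, with $(u,x)$ adjacent to $(v,y)$ iff either $u=v$ and $xy\in E(H)$, or $x=y$ and $uv\in E(G)$. For a graph $G$ with vertex set $\{1,\ldots,n\}$, $\mathcal S_-(G)$ is the set of real $n\times n$ matrices $A=[a_{ij}]$ with $A^T=-A$ and, for $i\ne j$, $a_{ij}\neq0$ iff $ij\in E(G)$; $\mathcal S_0(G)$ is the set of real $n\times n$ matrices $A=[a_{ij}]$ with $A^T=A$, $a_{ii}=0$ for all $i$, and, for $i\neq j$, $a_{ij}\ne0$ iff $ij\in E(G)$. Define $M_-(G)=\max_{A\in\mathcal S_-(G)}\operatorname{nullity}A$, $M_0(G)=\max_{A\in\mathcal S_0(G)}\operatorname{nullity}A$, and the minimum skew rank $\operatorname{mr}^-(G)=\min_{A\in\mathcal S_-(G)}\operatorname{rank}A=n-M_-(G)$.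 Skew zero forcing: vertices are colored blue or white. If a vertex $u$ of either color has exactly one white neighbor $v$, then $u$ may force $v$, i.e. $v$ becomes blue. A set $B\subseteq V(G)$ is a skew zero forcing set if, starting with exactly the vertices of $B$ blue, repeated legal forces can color all vertices blue. $Z_-(G)$ is the minimum cardinality of a skew zero forcing set. *)

theory Defs
  imports
    "Graph_Theory.Pair_Digraph"
    "Jordan_Normal_Form.Matrix_Kernel"
    "Jordan_Normal_Form.DL_Rank"
begin

text \<open>Finite simple graphs are the finite, loop-free, symmetric digraphs of the locale
  \<^locale>\<open>pair_graph\<close>: an edge $uv$ is the pair of arcs $(u,v)$, $(v,u)$.\<close>

definition path_graph :: "nat \<Rightarrow> nat pair_pre_digraph" where
  "path_graph n =
    \<lparr> pverts = {0..<n},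
      parcs = {(i, j). i < n \<and> j < n \<and> (j = i + 1 \<or> i = j + 1)} \<rparr>"

text \<open>The vertices are the residues modulo $n$; this is the cycle $C_n$ for $n \geq 3$.\<close>

definition cycle_graph :: "nat \<Rightarrow> nat pair_pre_digraph" where
  "cycle_graph n =
    \<lparr> pverts = {0..<n},
      parcs = {(i, j). i < n \<and> j < n \<and> (j = (i + 1) mod n \<or> i = (j + 1) mod n)} \<rparr>"

definition cartesian_product ::
  "'a pair_pre_digraph \<Rightarrow> 'b pair_pre_digraph \<Rightarrow> ('a \<times> 'b) pair_pre_digraph" where
  "cartesian_product G H =
    \<lparr> pverts = pverts G \<times> pverts H,
      parcs = {((u, x), (v, y)).
        u \<in> pverts G \<and> v \<in> pverts G \<and> x \<in> pverts H \<and> y \<in> pverts H \<and>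
        (u = v \<and> (x, y) \<in> parcs H \<or> x = y \<and> (u, v) \<in> parcs G)} \<rparr>"

lemma pair_graph_path_graph: "pair_graph (path_graph n)"
proof -
  have "finite (parcs (path_graph n))"
    by (rule finite_subset[of _ "{0..<n} \<times> {0..<n}"]) (auto simp: path_graph_def)
  then show ?thesis
    by unfold_locales (auto simp: path_graph_def symmetric_def intro!: symI)
qed

lemma pair_graph_cycle_graph: "3 \<le> n \<Longrightarrow> pair_graph (cycle_graph n)"
proof -
  assume n: "3 \<le> n"
  have fin: "finite (parcs (cycle_graph n))"
    by (rule finite_subset[of _ "{0..<n} \<times> {0..<n}"]) (auto simp: cycle_graph_def)
  have "Suc i mod n \<noteq> i" if "i < n" for i
    using n that by (cases "Suc i = n") auto
  with fin show ?thesis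
    by unfold_locales (fastforce simp: cycle_graph_def symmetric_def intro!: symI)+
qed

lemma pair_graph_cartesian_product:
  assumes "pair_graph G" "pair_graph H"
  shows "pair_graph (cartesian_product G H)"
proof -
  interpret G: pair_graph G by fact
  interpret H: pair_graph H by fact
  have "finite (parcs (cartesian_product G H))"
    by (rule finite_subset[of _ "(pverts G \<times> pverts H) \<times> (pverts G \<times> pverts H)"])
      (auto simp: cartesian_product_def)
  then show ?thesis
    using G.pair_no_loops H.pair_no_loops G.pair_sym_arcs H.pair_sym_arcs
    by unfold_locales (auto simp: cartesian_product_def symmetric_def intro!: symI dest: symD)
qed

text \<open>Matrix rows and columns are numbered $0, \ldots, n - 1$, whereas vertices are arbitrary.
  \<open>matrix_pattern G A\<close> therefore asks for some numbering \<open>f\<close> of the vertices under which the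
  off-diagonal nonzero pattern of the $n \times n$ matrix \<open>A\<close> is that of \<open>G\<close>. Changing the
  numbering conjugates \<open>A\<close> by a permutation matrix, so ranks and nullities do not depend on it.\<close>

definition matrix_pattern :: "'a pair_pre_digraph \<Rightarrow> real mat \<Rightarrow> bool" where
  "matrix_pattern G A \<longleftrightarrow>
    A \<in> carrier_mat (card (pverts G)) (card (pverts G)) \<and>
    (\<exists>f. bij_betw f {0..<card (pverts G)} (pverts G) \<and>
      (\<forall>i < card (pverts G). \<forall>j < card (pverts G). i \<noteq> j \<longrightarrow>
        (A $$ (i, j) \<noteq> 0 \<longleftrightarrow> (f i, f j) \<in> parcs G)))"

definition S_minus :: "'a pair_pre_digraph \<Rightarrow> real mat set" where
  "S_minus G = {A. matrix_pattern G A \<and> transpose_mat A = - A}"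

definition S_zero :: "'a pair_pre_digraph \<Rightarrow> real mat set" where
  "S_zero G = {A. matrix_pattern G A \<and> transpose_mat A = A \<and>
    (\<forall>i < card (pverts G). A $$ (i, i) = 0)}"

definition M_minus :: "'a pair_pre_digraph \<Rightarrow> nat" where
  "M_minus G = Max (kernel_dim ` S_minus G)"

definition M_zero :: "'a pair_pre_digraph \<Rightarrow> nat" where
  "M_zero G = Max (kernel_dim ` S_zero G)"

definition mr_minus :: "'a pair_pre_digraph \<Rightarrow> nat" where
  "mr_minus G = Min (vec_space.rank (card (pverts G)) ` S_minus G)"

text \<open>The maxima and minima above and below range over finite nonempty sets.\<close>

lemma kernel_dim_image_finite: "finite (kernel_dim ` {A. matrix_pattern G A \<and> P A})"
proof (rule finite_subset)
  show "kernel_dim ` {A. matrix_pattern G A \<and> P A} \<subseteq> {..card (pverts G)}"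
    by (auto simp: matrix_pattern_def kernel_dim_code)
qed simp

lemma rank_image_finite:
  "finite (vec_space.rank (card (pverts G)) ` {A. matrix_pattern G A \<and> P A})"
proof (rule finite_subset)
  show "vec_space.rank (card (pverts G)) ` {A. matrix_pattern G A \<and> P A}
      \<subseteq> {..card (pverts G)}"
    by (auto simp: matrix_pattern_def intro: vec_space.rank_le_nc)
qed simp

lemma S_minus_nonempty:
  assumes "pair_graph G"
  shows "S_minus G \<noteq> {}"
proof -
  interpret pair_graph G by fact
  let ?n = "card (pverts G)"
  obtain f where f: "bij_betw f {0..<?n} (pverts G)"
    using ex_bij_betw_nat_finite[OF pair_finite_verts] by blast
  let ?A = "mat ?n ?n (\<lambda>(i, j).
    if (f i, f j) \<in> parcs G then if i < j then 1 else - 1 else (0 :: real))"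
  have sym: "(u, v) \<in> parcs G \<longleftrightarrow> (v, u) \<in> parcs G" for u v
    using pair_sym_arcs by (auto simp: symmetric_def dest: symD)
  have irrefl: "(u, u) \<notin> parcs G" for u
    using pair_no_loops[of "(u, u)"] by auto
  have "transpose_mat ?A = - ?A"
    by (rule eq_matI) (auto simp: irrefl sym)
  moreover have "matrix_pattern G ?A"
    unfolding matrix_pattern_def using f by (intro conjI exI[of _ f]) auto
  ultimately show ?thesis
    unfolding S_minus_def by blast
qed

lemma S_zero_nonempty:
  assumes "pair_graph G"
  shows "S_zero G \<noteq> {}"
proof -
  interpret pair_graph G by fact
  let ?n = "card (pverts G)"
  obtain f where f: "bij_betw f {0..<?n} (pverts G)"
    using ex_bij_betw_nat_finite[OF pair_finite_verts] by blast
  let ?A = "mat ?n ?n (\<lambda>(i, j). if (f i, f j) \<in> parcs G then 1 else (0 :: real))"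
  have sym: "(u, v) \<in> parcs G \<longleftrightarrow> (v, u) \<in> parcs G" for u v
    using pair_sym_arcs by (auto simp: symmetric_def dest: symD)
  have irrefl: "(u, u) \<notin> parcs G" for u
    using pair_no_loops[of "(u, u)"] by auto
  have "transpose_mat ?A = ?A"
    by (rule eq_matI) (auto simp: sym)
  moreover have "matrix_pattern G ?A"
    unfolding matrix_pattern_def using f by (intro conjI exI[of _ f]) auto
  moreover have "\<forall>i < ?n. ?A $$ (i, i) = 0"
    by (auto simp: irrefl)
  ultimately show ?thesis
    unfolding S_zero_def by blast
qed

text \<open>\<open>B\<close> is the set of blue vertices. The forcing vertex \<open>u\<close> may itself be white.\<close>

definition skew_force :: "'a pair_pre_digraph \<Rightarrow> 'a set \<Rightarrow> 'a \<Rightarrow> 'a \<Rightarrow> bool" where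
  "skew_force G B u v \<longleftrightarrow>
    u \<in> pverts G \<and> {w \<in> pverts G. (u, w) \<in> parcs G \<and> w \<notin> B} = {v}"

inductive skew_reachable :: "'a pair_pre_digraph \<Rightarrow> 'a set \<Rightarrow> 'a set \<Rightarrow> bool"
  for G B where
  start: "skew_reachable G B B"
| force: "skew_reachable G B C \<Longrightarrow> skew_force G C u v \<Longrightarrow> skew_reachable G B (insert v C)"

definition skew_zero_forcing_set :: "'a pair_pre_digraph \<Rightarrow> 'a set \<Rightarrow> bool" where
  "skew_zero_forcing_set G B \<longleftrightarrow> B \<subseteq> pverts G \<and> skew_reachable G B (pverts G)"

definition Z_minus :: "'a pair_pre_digraph \<Rightarrow> nat" where
  "Z_minus G = Min (card ` {B. skew_zero_forcing_set G B})"

lemma skew_zero_forcing_sets_finite: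
  "finite (pverts G) \<Longrightarrow> finite {B. skew_zero_forcing_set G B}"
  by (rule finite_subset[of _ "Pow (pverts G)"]) (auto simp: skew_zero_forcing_set_def)

lemma skew_zero_forcing_set_pverts: "skew_zero_forcing_set G (pverts G)"
  by (simp add: skew_zero_forcing_set_def skew_reachable.start)

definition eta :: "nat \<Rightarrow> nat \<Rightarrow> nat" where
  "eta p c =
    (if even c then min (2 * p) c
     else if even p \<and> c \<le> p then c - 1
     else min p c)"

end

theory Submission
  imports Defs "HOL-Computational_Algebra.Polynomial"
begin

text \<open>
  Call a copy of the cycle a layer and a copy of the path a column.

  \<^bold>\<open>Upper bounds.\<close> A null vector that vanishes on a skew zero forcing set vanishes everywhere,
  because row \<open>u\<close> of the equation has a single possibly nonzero term as soon as \<open>u\<close> may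
  force; hence the nullity is at most the size of any such set (\<open>kernel_dim_le_card_forcing\<close>).
  One layer (\<open>c\<close> vertices) and two adjacent columns (\<open>2 p\<close> vertices) are forcing. For odd \<open>c\<close>
  a zigzag of \<open>p\<close> vertices already suffices: on the double cover of the cylinder, which is the
  cylinder of circumference \<open>2 c\<close>, the equations couple only one half of the chessboard, and the
  zigzag is what two adjacent columns leave on that half. Finally a skew-symmetric matrix has even
  rank (\<open>skew_kernel_dim_parity\<close>), so for \<open>c\<close> odd and \<open>p\<close> even the nullity cannot equal \<open>c\<close>.

  \<^bold>\<open>Lower bounds.\<close> Take a weighted path and a cycle with weights \<open>\<plusminus> 1\<close>, and combine them as
  in a Kronecker sum. Eigenvectors of the cycle are the sequences \<open>z ^ j\<close> with
  \<open>z ^ c = \<epsilon>\<close>, \<open>\<epsilon> = \<plusminus> 1\<close>, and a product of such an eigenvector with an eigenvector of the path is a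
  null vector whenever the two eigenvalues cancel. The path can be given any spectrum of \<open>p\<close>
  distinct values that is symmetric about \<open>0\<close>: its weights are read off the three-term recurrence
  of the polynomials orthogonal on that spectrum (\<open>jacobi_weights_exist\<close>). So the nullity is
  at least the number of roots \<open>z\<close> whose eigenvalue lies in the spectrum chosen for the path
  (\<open>cylinder_matrix_exists\<close>), and it remains to count. In the skew case the eigenvalue of \<open>z\<close> is
  \<open>2 i Im z\<close>. For odd \<open>c\<close> the \<open>c\<close> values are distinct and include \<open>0\<close>; an even \<open>p\<close> forces
  \<open>0\<close> out of the spectrum, which is where \<open>c - 1\<close> comes from. For even \<open>c\<close> every value is
  taken twice except \<open>\<plusminus> 2\<close>, taken at \<open>\<plusminus> i\<close>; the sign \<open>\<epsilon>\<close> decides whether \<open>\<plusminus> i\<close> are roots at all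
  and is chosen so that the number of distinct values has the parity of \<open>p\<close>. The
  symmetric matrices needed for \<open>M_zero\<close> arise in the same way from \<open>2 Re z\<close>; here the spectrum
  must contain the at most \<open>c + 1\<close> values \<open>\<plusminus> 2 Re z\<close>, which fit because \<open>p\<close> is even and \<open>p \<ge> c\<close>.
  As \<open>M_zero\<close> obeys the same forcing bound, it also shows that no forcing set is smaller than a layer.
\<close>

section \<open>Null vectors and the nullity\<close>

text \<open>
  Vectors are functions on indices, of which only the first \<open>n\<close> matter; this makes linear
  combinations and reindexing by vertices plain sums.
\<close>

definition null_vector :: "nat \<Rightarrow> real mat \<Rightarrow> (nat \<Rightarrow> real) \<Rightarrow> bool" where
  "null_vector n A x \<longleftrightarrow> (\<forall>i<n. (\<Sum>j<n. A $$ (i, j) * x j) = 0)"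

lemma singular_iff_null_vector:
  assumes A: "A \<in> carrier_mat n n"
  shows "det A = 0 \<longleftrightarrow> (\<exists>x. null_vector n A x \<and> (\<exists>i<n. x i \<noteq> 0))"
proof -
  have eq: "A *\<^sub>v v = 0\<^sub>v n \<longleftrightarrow> null_vector n A (($) v)" if "v \<in> carrier_vec n" for v
    using A that by (auto simp: null_vector_def vec_eq_iff scalar_prod_def atLeast0LessThan)
  show ?thesis
    unfolding det_0_iff_vec_prod_zero[OF A]
  proof safe
    fix v assume "v \<in> carrier_vec n" "v \<noteq> 0\<^sub>v n" "A *\<^sub>v v = 0\<^sub>v n"
    then show "\<exists>x. null_vector n A x \<and> (\<exists>i<n. x i \<noteq> 0)"
      using eq[of v] by (intro exI[of _ "($) v"]) (auto simp: vec_eq_iff)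
  next
    fix x i assume x: "null_vector n A x" "i < n" "x i \<noteq> 0"
    have "null_vector n A (($) (vec n x))" using x(1) by (simp add: null_vector_def)
    then show "\<exists>v. v \<in> carrier_vec n \<and> v \<noteq> 0\<^sub>v n \<and> A *\<^sub>v v = 0\<^sub>v n"
      using eq[of "vec n x"] x by (intro exI[of _ "vec n x"]) (auto simp: vec_eq_iff)
  qed
qed

text \<open>
  The system, padded with zero rows to a square one, has a zero row and hence determinant \<open>0\<close>.
\<close>

lemma underdetermined_system:
  fixes a :: "'i \<Rightarrow> 'j \<Rightarrow> real"
  assumes "finite I" "finite J" "card J < card I"
  obtains c where "\<exists>i\<in>I. c i \<noteq> 0" "\<And>j. j \<in> J \<Longrightarrow> (\<Sum>i\<in>I. c i * a i j) = 0"
proof -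
  define m where "m = card I"
  obtain f where f: "bij_betw f {..<m} I"
    using ex_bij_betw_nat_finite[OF assms(1)] by (auto simp: m_def atLeast0LessThan)
  obtain g where g: "bij_betw g {..<card J} J"
    using ex_bij_betw_nat_finite[OF assms(2)] by (auto simp: atLeast0LessThan)
  define M where "M = mat m m (\<lambda>(k, i). if k < card J then a (f i) (g k) else 0)"
  have M: "M \<in> carrier_mat m m" by (simp add: M_def)
  have "M = mat\<^sub>r m m (\<lambda>i. if i = m - 1 then 0\<^sub>v m else row M i)"
    using assms(3) by (auto simp: M_def m_def mat_of_rows_def intro!: eq_matI)
  also have "det \<dots> = 0"
    using assms(3) by (intro det_row_0) (auto simp: M_def m_def)
  finally obtain x i where x: "null_vector m M x" "i < m" "x i \<noteq> 0"
    using singular_iff_null_vector[OF M] by blast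
  define c where "c = (\<lambda>u. x (inv_into {..<m} f u))"
  have cf: "c (f k) = x k" if "k < m" for k
    using that f by (auto simp: c_def bij_betw_def inv_into_f_f)
  show thesis
  proof
    show "\<exists>i\<in>I. c i \<noteq> 0" using x cf f by (metis bij_betwE lessThan_iff)
    fix j assume "j \<in> J"
    then obtain k where k: "k < card J" "j = g k"
      using g by (metis bij_betw_imp_surj_on imageE lessThan_iff)
    have "(\<Sum>i\<in>I. c i * a i j) = (\<Sum>i<m. c (f i) * a (f i) j)"
      by (rule sum.reindex_bij_betw[OF f, symmetric])
    also have "\<dots> = (\<Sum>i<m. M $$ (k, i) * x i)"
      using k assms(3) by (intro sum.cong) (auto simp: M_def m_def cf)
    also have "\<dots> = 0" using x(1) k assms(3) by (auto simp: null_vector_def m_def)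
    finally show "(\<Sum>i\<in>I. c i * a i j) = 0" .
  qed
qed

lemma null_vector_sum:
  assumes "\<And>t. t \<in> T \<Longrightarrow> null_vector n A (x t)"
  shows "null_vector n A (\<lambda>j. \<Sum>t\<in>T. c t * x t j)"
proof -
  have "(\<Sum>j<n. A $$ (i, j) * (\<Sum>t\<in>T. c t * x t j)) = (\<Sum>t\<in>T. c t * (\<Sum>j<n. A $$ (i, j) * x t j))" for i
    unfolding sum_distrib_left by (subst sum.swap) (simp add: mult_ac)
  then show ?thesis using assms by (simp add: null_vector_def)
qed

text \<open>
  \<open>F\<close> consists of the non-pivot columns of the reduced row echelon form. They serve as coordinates on
  the kernel: \<open>w\<close> is the basis dual to them, and a null vector vanishing on them is zero. All later
  statements about the nullity go through this description.
\<close>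

lemma kernel_free_coordinates:
  assumes A: "A \<in> carrier_mat n n"
  obtains F w where "F \<subseteq> {..<n}" "card F = kernel_dim A"
    "\<And>c. c \<in> F \<Longrightarrow> null_vector n A (w c)"
    "\<And>c d. c \<in> F \<Longrightarrow> d \<in> F \<Longrightarrow> w c d = (if d = c then 1 else 0)"
    "\<And>x i. null_vector n A x \<Longrightarrow> (\<And>c. c \<in> F \<Longrightarrow> x c = 0) \<Longrightarrow> i < n \<Longrightarrow> x i = 0"
proof -
  let ?B = "gauss_jordan_single A"
  from gauss_jordan_single[OF A refl] obtain P Q where AB: "?B = P * A" and QP: "Q * P = 1\<^sub>m n"
    and P: "P \<in> carrier_mat n n" and Q: "Q \<in> carrier_mat n n" and B: "?B \<in> carrier_mat n n"
    and row: "row_echelon_form ?B" by auto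
  have ker: "mat_kernel ?B = mat_kernel A"
    using mat_kernel_mult_eq[OF A P Q QP] AB by simp
  have mk: "v \<in> mat_kernel A \<longleftrightarrow> null_vector n A (($) v)" if "v \<in> carrier_vec n" for v
    using A that by (auto simp: mat_kernel_def null_vector_def vec_eq_iff scalar_prod_def atLeast0LessThan)
  interpret K: kernel n n ?B by unfold_locales (rule B)
  define Pv where "Pv = snd ` set (pivot_positions ?B)"
  define F where "F = {..<n} - Pv"
  define b where "b = non_pivot_base ?B (pivot_positions ?B)"
  note npb = non_pivot_base[OF row B, folded Pv_def b_def]
  have bF: "b c \<in> mat_kernel A" "b c $ c = 1" "b c \<in> carrier_vec n" if "c \<in> F" for c
    using npb(1-3)[of c] that mat_kernelI[OF B, of "b c"] unfolding ker by (auto simp: F_def)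
  have bF0: "b c $ d = 0" if "c \<in> F" "d \<in> F" "c \<noteq> d" for c d
    using npb(4)[of c d] that by (auto simp: F_def)
  have inj: "inj_on b F" using bF bF0 by (intro inj_onI) (metis zero_neq_one)
  have base: "set (find_base_vectors ?B) = b ` F"
    using B by (auto simp: find_base_vectors_def Let_def F_def Pv_def b_def)
  show thesis
  proof (rule that[of F "\<lambda>c. ($) (b c)"])
    show "F \<subseteq> {..<n}" by (auto simp: F_def)
    have "kernel_dim A = K.dim"
      using ker A B unfolding kernel_dim_def by simp
    also have "\<dots> = card (b ` F)"
      using find_base_vectors(4,6)[OF row B] base by simp
    finally show "card F = kernel_dim A" using card_image[OF inj] by simp
    show "null_vector n A (($) (b c))" if "c \<in> F" for c using mk[of "b c"] bF[OF that] by simp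
    show "b c $ d = (if d = c then 1 else 0)" if "c \<in> F" "d \<in> F" for c d
      using bF bF0 that by auto
    fix x i assume x: "null_vector n A x" "\<And>c. c \<in> F \<Longrightarrow> x c = 0" "i < n"
    have "vec n x \<in> mat_kernel A" using mk[of "vec n x"] x(1) by (simp add: null_vector_def)
    moreover have "K.span (b ` F) = mat_kernel A"
      using find_base_vectors(3)[OF row B] base ker unfolding K.Ker.basis_def by simp
    moreover have fin: "finite (b ` F)" by (simp add: F_def)
    moreover have sub: "b ` F \<subseteq> mat_kernel ?B" using bF ker by auto
    ultimately obtain a where a: "vec n x = K.lincomb a (b ` F)"
      using K.Ker.finite_in_span[of "b ` F" "vec n x"] by (metis (no_types))
    have coord: "x j = (\<Sum>c\<in>F. a (b c) * b c $ j)" if "j < n" for j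
    proof -
      have "x j = K.lincomb a (b ` F) $ j" using that a[symmetric] by simp
      also have "\<dots> = (\<Sum>c\<in>F. a (b c) * b c $ j)"
        unfolding K.lincomb_index[OF that sub] by (simp add: sum.reindex[OF inj])
      finally show ?thesis .
    qed
    have "a (b c) = 0" if "c \<in> F" for c
    proof -
      have "c < n" using that by (simp add: F_def)
      have "x c = (\<Sum>d\<in>F. if d = c then a (b c) else 0)"
        unfolding coord[OF \<open>c < n\<close>] using bF bF0 that by (intro sum.cong) auto
      also have "\<dots> = a (b c)" using that by (simp add: F_def)
      finally show ?thesis using x(2)[OF that] by simp
    qed
    then show "x i = 0" using coord[OF x(3)] by simp
  qed
qed

text \<open>
  Both bounds on the nullity are instances of this comparison. If \<open>T\<close> were larger than \<open>B\<close>, some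
  nontrivial combination of the \<open>x t\<close> would vanish on \<open>B\<close>, hence everywhere, although its values
  at the \<open>b t\<close> are its coefficients.
\<close>

lemma card_dual_le_card_determining:
  assumes "finite T" "finite B"
    and "\<And>t. t \<in> T \<Longrightarrow> null_vector n A (x t)"
    and "\<And>t. t \<in> T \<Longrightarrow> b t < n"
    and dual: "\<And>t u. t \<in> T \<Longrightarrow> u \<in> T \<Longrightarrow> x t (b u) = (if u = t then 1 else 0)"
    and det: "\<And>y i. null_vector n A y \<Longrightarrow> (\<And>c. c \<in> B \<Longrightarrow> y c = 0) \<Longrightarrow> i < n \<Longrightarrow> y i = 0"
  shows "card T \<le> card B"
proof (rule ccontr)
  assume "\<not> card T \<le> card B"
  then obtain c where c: "\<exists>t\<in>T. c t \<noteq> 0" "\<And>j. j \<in> B \<Longrightarrow> (\<Sum>t\<in>T. c t * x t j) = 0"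
    using underdetermined_system[of T B x] assms(1,2) by (metis not_le)
  let ?y = "\<lambda>j. \<Sum>t\<in>T. c t * x t j"
  have "null_vector n A ?y" using assms(3) by (rule null_vector_sum)
  then have y: "?y i = 0" if "i < n" for i using det[of ?y] c(2) that by blast
  have "c u = 0" if "u \<in> T" for u
  proof -
    have "?y (b u) = (\<Sum>t\<in>T. if t = u then c u else 0)"
      using dual that by (intro sum.cong) auto
    also have "\<dots> = c u" using that assms(1) by simp
    finally show ?thesis using y assms(4) that by simp
  qed
  then show False using c(1) by blast
qed

lemma kernel_dim_le:
  assumes A: "A \<in> carrier_mat n n" and "finite B"
    and det: "\<And>y i. null_vector n A y \<Longrightarrow> (\<And>c. c \<in> B \<Longrightarrow> y c = 0) \<Longrightarrow> i < n \<Longrightarrow> y i = 0"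
  shows "kernel_dim A \<le> card B"
proof -
  obtain F w where F: "F \<subseteq> {..<n}" "card F = kernel_dim A"
    "\<And>c. c \<in> F \<Longrightarrow> null_vector n A (w c)"
    "\<And>c d. c \<in> F \<Longrightarrow> d \<in> F \<Longrightarrow> w c d = (if d = c then 1 else 0)"
    by (rule kernel_free_coordinates[OF A]) blast
  have "card F \<le> card B"
    by (rule card_dual_le_card_determining[of F B n A w id])
      (use F det assms(2) finite_subset[OF F(1)] in auto)
  then show ?thesis using F by simp
qed

lemma kernel_dim_ge:
  assumes A: "A \<in> carrier_mat n n" and "finite T"
    and "\<And>t. t \<in> T \<Longrightarrow> null_vector n A (x t)"
    and "\<And>t. t \<in> T \<Longrightarrow> b t < n"
    and "\<And>t u. t \<in> T \<Longrightarrow> u \<in> T \<Longrightarrow> x t (b u) = (if u = t then 1 else 0)"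
  shows "card T \<le> kernel_dim A"
proof -
  obtain F where F: "F \<subseteq> {..<n}" "card F = kernel_dim A"
    "\<And>x i. null_vector n A x \<Longrightarrow> (\<And>c. c \<in> F \<Longrightarrow> x c = 0) \<Longrightarrow> i < n \<Longrightarrow> x i = 0"
    by (rule kernel_free_coordinates[OF A]) blast
  have "card T \<le> card F"
    by (rule card_dual_le_card_determining[of T F n A x b])
      (use assms F finite_subset[OF F(1)] in auto)
  then show ?thesis using F by simp
qed

lemma odd_skew_singular:
  fixes A :: "real mat"
  assumes A: "A \<in> carrier_mat n n" and skew: "transpose_mat A = - A" and "odd n"
  shows "det A = 0"
proof -
  have "det A = det (transpose_mat A)" using det_transpose[OF A] by simp
  also have "\<dots> = det ((-1) \<cdot>\<^sub>m A)" using skew A by (intro arg_cong[of _ _ det]) auto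
  also have "\<dots> = - det A" using A assms(3) by simp
  finally show ?thesis by simp
qed

text \<open>
  The rank of a skew-symmetric matrix is even. The principal submatrix on the pivot coordinates is
  skew-symmetric of order the rank, so it suffices that it is nonsingular. Extend a null vector of
  it by \<open>0\<close> to \<open>x\<close>. Then \<open>A x\<close> is supported on the free coordinates \<open>F\<close>, and pairing it with the
  dual kernel vector \<open>w c\<close> gives on one hand its coordinate at \<open>c\<close>, on the other hand
  \<open>- (A w c) x = 0\<close>. So \<open>x\<close> is a null vector of \<open>A\<close> vanishing on \<open>F\<close>, and \<open>x = 0\<close>.
\<close>

lemma skew_kernel_dim_parity:
  fixes A :: "real mat"
  assumes A: "A \<in> carrier_mat n n" and skew: "transpose_mat A = - A"
  shows "even (n - kernel_dim A)"
proof (rule ccontr)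
  assume odd: "odd (n - kernel_dim A)"
  obtain F w where F: "F \<subseteq> {..<n}" "card F = kernel_dim A"
    "\<And>c. c \<in> F \<Longrightarrow> null_vector n A (w c)"
    "\<And>c d. c \<in> F \<Longrightarrow> d \<in> F \<Longrightarrow> w c d = (if d = c then 1 else 0)"
    "\<And>x i. null_vector n A x \<Longrightarrow> (\<And>c. c \<in> F \<Longrightarrow> x c = 0) \<Longrightarrow> i < n \<Longrightarrow> x i = 0"
    by (rule kernel_free_coordinates[OF A]) blast
  have sk: "A $$ (i, j) = - A $$ (j, i)" if "i < n" "j < n" for i j
    using arg_cong[OF skew, of "\<lambda>M. M $$ (j, i)"] A that by simp
  define G where "G = {..<n} - F"
  define m where "m = card G"
  have m: "m = n - kernel_dim A" using F(1,2) by (simp add: m_def G_def card_Diff_subset finite_subset)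
  obtain g where g: "bij_betw g {..<m} G"
    using ex_bij_betw_nat_finite[of G] by (auto simp: m_def G_def atLeast0LessThan)
  define M where "M = mat m m (\<lambda>(k, l). A $$ (g k, g l))"
  have gn: "g k < n" "g k \<notin> F" if "k < m" for k using g that by (auto simp: G_def bij_betw_def)
  have M: "M \<in> carrier_mat m m" by (simp add: M_def)
  have "transpose_mat M = - M"
    by (rule eq_matI) (auto simp: M_def gn intro: sk)
  then have "det M = 0" using odd_skew_singular[OF M] odd m by simp
  then obtain z k where z: "null_vector m M z" "k < m" "z k \<noteq> 0"
    using singular_iff_null_vector[OF M] by blast
  define x where "x j = (if j \<in> G then z (inv_into {..<m} g j) else 0)" for j
  have xg: "x (g l) = z l" if "l < m" for l
    using that g by (auto simp: x_def bij_betw_def inv_into_f_f)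
  have xF: "x c = 0" if "c \<in> F" for c using that by (auto simp: x_def G_def)
  define y where "y i = (\<Sum>j<n. A $$ (i, j) * x j)" for i
  have yG: "y i = 0" if "i \<in> G" for i
  proof -
    obtain l where l: "l < m" "i = g l" using g \<open>i \<in> G\<close> by (metis bij_betw_imp_surj_on imageE lessThan_iff)
    have "y i = (\<Sum>j\<in>G. A $$ (i, j) * x j)"
      unfolding y_def by (rule sum.mono_neutral_right) (auto simp: G_def xF)
    also have "\<dots> = (\<Sum>q<m. A $$ (i, g q) * x (g q))"
      by (rule sum.reindex_bij_betw[OF g, symmetric])
    also have "\<dots> = (\<Sum>q<m. M $$ (l, q) * z q)"
      using l by (intro sum.cong) (auto simp: M_def xg)
    also have "\<dots> = 0" using z(1) l by (simp add: null_vector_def)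
    finally show ?thesis .
  qed
  have yF: "y c = 0" if "c \<in> F" for c
  proof -
    have wA: "(\<Sum>i<n. w c i * A $$ (i, j)) = 0" if "j < n" for j
    proof -
      have "(\<Sum>i<n. w c i * A $$ (i, j)) = (\<Sum>i<n. - (A $$ (j, i) * w c i))"
      proof (rule sum.cong)
        fix i assume "i \<in> {..<n}"
        then show "w c i * A $$ (i, j) = - (A $$ (j, i) * w c i)" using sk[of i j] that by simp
      qed simp
      then show ?thesis using F(3)[OF \<open>c \<in> F\<close>] that by (simp add: sum_negf null_vector_def)
    qed
    have "(\<Sum>i<n. w c i * y i) = (\<Sum>j<n. (\<Sum>i<n. w c i * A $$ (i, j)) * x j)"
      unfolding y_def sum_distrib_left sum_distrib_right by (subst sum.swap) (simp add: mult_ac)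
    also have "\<dots> = 0" by (simp add: wA)
    finally have "0 = (\<Sum>i<n. w c i * y i)" by simp
    also have "\<dots> = (\<Sum>i\<in>F. w c i * y i)"
      using F(1) yG by (intro sum.mono_neutral_right) (auto simp: G_def)
    also have "\<dots> = (\<Sum>i\<in>F. if i = c then y c else 0)"
      using F(4) that by (intro sum.cong) auto
    also have "\<dots> = y c" using that finite_subset[OF F(1)] by simp
    finally show ?thesis by simp
  qed
  have "null_vector n A x" using yG yF by (auto simp: null_vector_def y_def G_def)
  then have "x (g k) = 0" using F(5)[of x] xF gn z(2) by blast
  then show False using xg z by simp
qed

lemma rank_plus_kernel_dim:
  fixes A :: "real mat"
  assumes A: "A \<in> carrier_mat n m"
  shows "vec_space.rank n A + kernel_dim A = m"
proof -
  interpret V: vec_space "TYPE(real)" m .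
  interpret W: vec_space "TYPE(real)" n .
  interpret K: kernel n m A by unfold_locales (rule A)
  interpret L: linear_map class_ring V.V W.V "(*\<^sub>v) A"
  proof unfold_locales
    show "(*\<^sub>v) A \<in> LinearCombinations.module_hom class_ring V.V W.V"
      using A by (auto simp: LinearCombinations.module_hom_def module_vec_simps
          mult_add_distrib_mat_vec[OF A] mult_mat_vec[OF A])
  qed
  have ker: "L.kerT = mat_kernel A"
    using A by (auto simp: L.ker_def mat_kernel_def)
  have im: "L.imT = W.span (set (cols A))"
  proof -
    have "L.imT = (*\<^sub>v) A ` carrier_vec m" by (simp add: L.im_def module_vec_simps)
    also have "\<dots> = W.col_space A" unfolding W.col_space_eq[OF A] using A by auto
    finally show ?thesis unfolding W.col_space_def .
  qed
  have "vectorspace.dim class_ring (W.vs L.imT) + vectorspace.dim class_ring (V.vs L.kerT) = V.dim"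
    by (rule L.rank_nullity) (rule V.fin_dim)
  then show ?thesis
    unfolding im ker W.rank_def[symmetric] by (simp add: V.dim_is_n K.kernel_dim)
qed

section \<open>Skew zero forcing\<close>

text \<open>
  A maximal reachable set \<open>D\<close> admits no further force, so it is enough to show that every set that
  contains \<open>B\<close> and admits no further force contains all vertices. This avoids exhibiting an order of forces.
\<close>

lemma skew_zero_forcing_setI:
  assumes "finite (pverts G)" "B \<subseteq> pverts G"
    and closed: "\<And>D. B \<subseteq> D \<Longrightarrow> D \<subseteq> pverts G \<Longrightarrow>
      (\<And>u v. (u, v) \<in> parcs G \<Longrightarrow> u \<in> pverts G \<Longrightarrow> v \<in> pverts G \<Longrightarrow>
        (\<And>w. w \<in> pverts G \<Longrightarrow> (u, w) \<in> parcs G \<Longrightarrow> w \<noteq> v \<Longrightarrow> w \<in> D) \<Longrightarrow> v \<in> D) \<Longrightarrow>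
      pverts G \<subseteq> D"
  shows "skew_zero_forcing_set G B"
proof -
  let ?R = "{C. skew_reachable G B C}"
  have "C \<subseteq> pverts G \<and> B \<subseteq> C" if "skew_reachable G B C" for C
    using that by induction (use assms(2) in \<open>auto simp: skew_force_def\<close>)
  then have sub: "?R \<subseteq> Pow (pverts G)" and B: "\<And>C. C \<in> ?R \<Longrightarrow> B \<subseteq> C" by auto
  have "finite ?R" using assms(1) by (intro finite_subset[OF sub]) simp
  moreover have "?R \<noteq> {}" using skew_reachable.start by blast
  ultimately obtain D where D: "D \<in> ?R" "\<And>C. C \<in> ?R \<Longrightarrow> D \<subseteq> C \<Longrightarrow> D = C"
    using finite_has_maximal[of ?R] by metis
  have "pverts G \<subseteq> D"
  proof (rule closed)
    show "B \<subseteq> D" "D \<subseteq> pverts G" using B D(1) sub by auto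
    fix u v assume uv: "(u, v) \<in> parcs G" "u \<in> pverts G" "v \<in> pverts G"
      "\<And>w. w \<in> pverts G \<Longrightarrow> (u, w) \<in> parcs G \<Longrightarrow> w \<noteq> v \<Longrightarrow> w \<in> D"
    show "v \<in> D"
    proof (rule ccontr)
      assume "v \<notin> D"
      then have "skew_force G D u v" using uv by (auto simp: skew_force_def)
      then have "insert v D \<in> ?R" using D(1) by (auto intro: skew_reachable.force)
      then show False using D(2)[of "insert v D"] \<open>v \<notin> D\<close> by blast
    qed
  qed
  then have "D = pverts G" using D(1) sub by auto
  then show ?thesis using D(1) assms(2) by (auto simp: skew_zero_forcing_set_def)
qed

text \<open>
  When \<open>u\<close> forces \<open>v\<close>, the row of \<open>u\<close> reads \<open>A u v * x v = 0\<close>. Since the diagonal is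
  zero, \<open>x u\<close> does not occur in this row, so \<open>u\<close> may be white.
\<close>

lemma null_vector_zero_on_reachable:
  assumes f: "bij_betw f {..<n} (pverts G)"
    and pat: "\<And>i j. i < n \<Longrightarrow> j < n \<Longrightarrow> A $$ (i, j) \<noteq> 0 \<longleftrightarrow> (f i, f j) \<in> parcs G"
    and x: "null_vector n A x" and B: "\<And>i. i < n \<Longrightarrow> f i \<in> B \<Longrightarrow> x i = 0"
    and "skew_reachable G B C"
  shows "\<forall>i<n. f i \<in> C \<longrightarrow> x i = 0"
  using assms(5)
proof induction
  case start
  then show ?case using B by blast
next
  case (force C u v)
  from force.hyps(2) have u: "u \<in> pverts G" and
    white: "\<And>w. w \<in> pverts G \<and> (u, w) \<in> parcs G \<and> w \<notin> C \<longleftrightarrow> w = v"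
    by (auto simp: skew_force_def)
  then obtain i where i: "i < n" "f i = u" using f by (metis bij_betw_imp_surj_on imageE lessThan_iff)
  from white obtain k where k: "k < n" "f k = v" using f by (metis bij_betw_imp_surj_on imageE lessThan_iff)
  have fj: "f j \<in> pverts G" if "j < n" for j using f that by (auto dest: bij_betwE)
  have inj: "j = k" if "f j = v" "j < n" for j
    using f k that by (auto simp: bij_betw_def dest: inj_onD)
  have other: "A $$ (i, j) * x j = 0" if "j < n" "j \<noteq> k" for j
    using white[of "f j"] fj inj pat[of i j] i that force.IH by (cases "A $$ (i, j) = 0") auto
  have "0 = (\<Sum>j<n. A $$ (i, j) * x j)" using x i by (simp add: null_vector_def)
  also have "\<dots> = (\<Sum>j<n. if j = k then A $$ (i, k) * x k else 0)"
    by (intro sum.cong) (auto simp: other)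
  also have "\<dots> = A $$ (i, k) * x k" using k by simp
  finally have "x k = 0" using pat[of i k] i k white by auto
  then show ?case using force.IH inj by auto
qed

lemma kernel_dim_le_card_forcing:
  assumes G: "finite (pverts G)" "\<And>u. (u, u) \<notin> parcs G"
    and A: "matrix_pattern G A" "\<And>i. i < card (pverts G) \<Longrightarrow> A $$ (i, i) = 0"
    and B: "skew_zero_forcing_set G B"
  shows "kernel_dim A \<le> card B"
proof -
  let ?n = "card (pverts G)"
  from A(1) obtain f where f: "bij_betw f {..<?n} (pverts G)" and Ac: "A \<in> carrier_mat ?n ?n"
    and pat: "\<And>i j. i < ?n \<Longrightarrow> j < ?n \<Longrightarrow> i \<noteq> j \<Longrightarrow> A $$ (i, j) \<noteq> 0 \<longleftrightarrow> (f i, f j) \<in> parcs G"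
    by (auto simp: matrix_pattern_def atLeast0LessThan)
  define B' where "B' = {i. i < ?n \<and> f i \<in> B}"
  have img: "f ` B' = B" "inj_on f B'"
    using f B by (auto simp: B'_def skew_zero_forcing_set_def bij_betw_def inj_on_def)
  have "kernel_dim A \<le> card B'"
  proof (rule kernel_dim_le[OF Ac])
    show "finite B'" by (simp add: B'_def)
    fix y i assume y: "null_vector ?n A y" "\<And>c. c \<in> B' \<Longrightarrow> y c = 0" "i < ?n"
    have "\<forall>i<?n. f i \<in> pverts G \<longrightarrow> y i = 0"
    proof (rule null_vector_zero_on_reachable[OF f _ y(1)])
      show "A $$ (i, j) \<noteq> 0 \<longleftrightarrow> (f i, f j) \<in> parcs G" if "i < ?n" "j < ?n" for i j
        using pat that A(2) G(2) by (cases "i = j") auto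
      show "y i = 0" if "i < ?n" "f i \<in> B" for i using y that by (simp add: B'_def)
      show "skew_reachable G B (pverts G)" using B by (simp add: skew_zero_forcing_set_def)
    qed
    then show "y i = 0" using f y(3) by (auto dest: bij_betwE)
  qed
  then show ?thesis using card_image[OF img(2)] img(1) by simp
qed

abbreviation (input) cylinder :: "nat \<Rightarrow> nat \<Rightarrow> (nat \<times> nat) pair_pre_digraph" where
  "cylinder p c \<equiv> cartesian_product (path_graph p) (cycle_graph c)"

lemma pverts_cylinder: "pverts (cylinder p c) = {..<p} \<times> {..<c}"
  by (auto simp: cartesian_product_def path_graph_def cycle_graph_def)

lemma card_pverts_cylinder: "card (pverts (cylinder p c)) = p * c"
  by (simp add: pverts_cylinder)

lemma parcs_cylinder:
  "((i, j), (k, l)) \<in> parcs (cylinder p c) \<longleftrightarrow> i < p \<and> k < p \<and> j < c \<and> l < c \<and>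
    (i = k \<and> (l = Suc j mod c \<or> j = Suc l mod c) \<or> j = l \<and> (k = Suc i \<or> i = Suc k))"
  by (auto simp: cartesian_product_def path_graph_def cycle_graph_def)

lemma pair_graph_cylinder: "c \<ge> 3 \<Longrightarrow> pair_graph (cylinder p c)"
  by (intro pair_graph_cartesian_product pair_graph_path_graph pair_graph_cycle_graph)

lemma pair_graph_loop_free:
  assumes "pair_graph G"
  shows "(u, u) \<notin> parcs G"
proof -
  interpret pair_graph G by fact
  show ?thesis using pair_no_loops[of "(u, u)"] by auto
qed

text \<open>
  Columns are counted by a natural number that is only reduced modulo \<open>c\<close> when it names a vertex, so that
  forcing can run around the cylinder more than once.
\<close>

lemma cylinder_neighbours:
  assumes "((i, Suc h mod c), w) \<in> parcs (cylinder p c)"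
  shows "w = (i, h mod c) \<or> w = (i, Suc (Suc h) mod c) \<or>
    (\<exists>g<p. w = (g, Suc h mod c) \<and> (i = Suc g \<or> g = Suc i))"
proof -
  have "l = h mod c" if "Suc h mod c = Suc l mod c" "l < c" for l
    using that by (simp add: mod_Suc split: if_splits)
  then show ?thesis using assms by (cases w) (auto simp: parcs_cylinder mod_Suc_eq)
qed

lemma layer_forcing:
  assumes "p \<ge> 1"
  shows "skew_zero_forcing_set (cylinder p c) ({0} \<times> {..<c})"
proof (rule skew_zero_forcing_setI)
  fix D assume D: "{0} \<times> {..<c} \<subseteq> D"
    and cl: "\<And>u v. (u, v) \<in> parcs (cylinder p c) \<Longrightarrow> u \<in> pverts (cylinder p c) \<Longrightarrow>
      v \<in> pverts (cylinder p c) \<Longrightarrow> (\<And>w. w \<in> pverts (cylinder p c) \<Longrightarrow>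
        (u, w) \<in> parcs (cylinder p c) \<Longrightarrow> w \<noteq> v \<Longrightarrow> w \<in> D) \<Longrightarrow> v \<in> D"
  have "\<forall>j<c. (i, j) \<in> D" if "i < p" for i
    using that
  proof (induction i rule: less_induct)
    case (less i)
    show ?case
    proof (cases i)
      case 0
      then show ?thesis using D by auto
    next
      case (Suc h)
      have "(i, j) \<in> D" if "j < c" for j
        by (rule cl[of "(h, j)"])
          (use Suc less that in \<open>auto simp: pverts_cylinder parcs_cylinder\<close>)
      then show ?thesis by blast
    qed
  qed
  then show "pverts (cylinder p c) \<subseteq> D" by (auto simp: pverts_cylinder)
qed (use assms in \<open>auto simp: pverts_cylinder\<close>)

lemma two_columns_forcing:
  assumes "c \<ge> 2"
  shows "skew_zero_forcing_set (cylinder p c) ({..<p} \<times> {0, 1})"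
proof (rule skew_zero_forcing_setI)
  fix D assume D: "{..<p} \<times> {0, 1} \<subseteq> D"
    and cl: "\<And>u v. (u, v) \<in> parcs (cylinder p c) \<Longrightarrow> u \<in> pverts (cylinder p c) \<Longrightarrow>
      v \<in> pverts (cylinder p c) \<Longrightarrow> (\<And>w. w \<in> pverts (cylinder p c) \<Longrightarrow>
        (u, w) \<in> parcs (cylinder p c) \<Longrightarrow> w \<noteq> v \<Longrightarrow> w \<in> D) \<Longrightarrow> v \<in> D"
  have col: "\<forall>i<p. (i, k mod c) \<in> D" for k
  proof (induction k rule: less_induct)
    case (less k)
    show ?case
    proof (cases "k \<le> 1")
      case True
      then show ?thesis using D assms by (auto simp: le_Suc_eq)
    next
      case False
      then obtain h where h: "k = Suc (Suc h)" by (metis One_nat_def not_less_eq_eq old.nat.exhaust zero_le)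
      have "(i, k mod c) \<in> D" if i: "i < p" for i
      proof (rule cl[of "(i, Suc h mod c)"])
        fix w assume "w \<noteq> (i, k mod c)" "((i, Suc h mod c), w) \<in> parcs (cylinder p c)"
        then show "w \<in> D"
          using cylinder_neighbours[of i h c w p] less.IH[of h] less.IH[of "Suc h"] i h by auto
      qed (use i h assms in \<open>auto simp: pverts_cylinder parcs_cylinder mod_Suc_eq\<close>)
      then show ?thesis by blast
    qed
  qed
  show "pverts (cylinder p c) \<subseteq> D"
  proof
    fix v assume "v \<in> pverts (cylinder p c)"
    then show "v \<in> D" using col[of "snd v"] by (cases v) (auto simp: pverts_cylinder)
  qed
qed (use assms in \<open>auto simp: pverts_cylinder\<close>)

text \<open>
  Call \<open>(i, k)\<close> of the right colour if \<open>i + k\<close> is even, where \<open>k\<close> runs over all natural numbers. A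
  vertex of the wrong colour in column \<open>k\<close> sees right-coloured vertices of columns \<open>k - 1\<close>, \<open>k\<close>
  and \<open>k + 1\<close> only, so two consecutive columns of this colour force the next one. Since \<open>c\<close> is odd,
  every vertex has the right colour on the first or on the second way around.
\<close>

lemma zigzag_forcing:
  assumes "c \<ge> 3" "odd c"
  shows "skew_zero_forcing_set (cylinder p c) ((\<lambda>i. (i, i mod 2)) ` {..<p})"
proof (rule skew_zero_forcing_setI)
  fix D assume D: "(\<lambda>i. (i, i mod 2)) ` {..<p} \<subseteq> D"
    and cl: "\<And>u v. (u, v) \<in> parcs (cylinder p c) \<Longrightarrow> u \<in> pverts (cylinder p c) \<Longrightarrow>
      v \<in> pverts (cylinder p c) \<Longrightarrow> (\<And>w. w \<in> pverts (cylinder p c) \<Longrightarrow>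
        (u, w) \<in> parcs (cylinder p c) \<Longrightarrow> w \<noteq> v \<Longrightarrow> w \<in> D) \<Longrightarrow> v \<in> D"
  have zig: "\<forall>i<p. even (i + k) \<longrightarrow> (i, k mod c) \<in> D" for k
  proof (induction k rule: less_induct)
    case (less k)
    show ?case
    proof (cases "k \<le> 1")
      case True
      then have "i mod 2 = k mod c" if "even (i + k)" for i
      proof -
        have "i mod 2 = k" using that \<open>k \<le> 1\<close> by presburger
        then show ?thesis using \<open>k \<le> 1\<close> assms by simp
      qed
      moreover have "(i, i mod 2) \<in> D" if "i < p" for i using D that by blast
      ultimately show ?thesis by metis
    next
      case False
      then obtain h where h: "k = Suc (Suc h)" by (metis One_nat_def not_less_eq_eq old.nat.exhaust zero_le)
      have "(i, k mod c) \<in> D" if i: "i < p" "even (i + k)" for i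
      proof (rule cl[of "(i, Suc h mod c)"])
        fix w assume "w \<noteq> (i, k mod c)" "((i, Suc h mod c), w) \<in> parcs (cylinder p c)"
        then consider "w = (i, h mod c)" | g where "w = (g, Suc h mod c)" "i = Suc g \<or> g = Suc i" "g < p"
          using cylinder_neighbours[of i h c w p] h by blast
        then show "w \<in> D"
          using less.IH[of h] less.IH[of "Suc h"] i h by cases auto
      qed (use i h assms in \<open>auto simp: pverts_cylinder parcs_cylinder mod_Suc_eq\<close>)
      then show ?thesis by blast
    qed
  qed
  have "(i, j) \<in> D" if "i < p" "j < c" for i j
  proof (cases "even (i + j)")
    case True
    then show ?thesis using zig[of j] that by auto
  next
    case False
    \<comment> \<open>The second way around meets column \<open>j\<close> at \<open>j + c\<close>, of the other parity.\<close>
    then show ?thesis using zig[of "j + c"] that assms by auto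
  qed
  then show "pverts (cylinder p c) \<subseteq> D" by (auto simp: pverts_cylinder)
qed (use assms in \<open>auto simp: pverts_cylinder intro: less_trans[of _ 2]\<close>)

section \<open>Graph parameters and forcing sets\<close>

lemma kernel_dim_le_M_minus: "A \<in> S_minus G \<Longrightarrow> kernel_dim A \<le> M_minus G"
  unfolding M_minus_def S_minus_def
  by (intro Max_ge kernel_dim_image_finite) auto

lemma kernel_dim_le_M_zero: "A \<in> S_zero G \<Longrightarrow> kernel_dim A \<le> M_zero G"
  unfolding M_zero_def S_zero_def
  by (intro Max_ge kernel_dim_image_finite) auto

lemma M_minus_attained:
  assumes "pair_graph G"
  obtains A where "A \<in> S_minus G" "kernel_dim A = M_minus G"
proof -
  have "finite (kernel_dim ` S_minus G)"
    unfolding S_minus_def by (rule kernel_dim_image_finite)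
  then have "M_minus G \<in> kernel_dim ` S_minus G"
    unfolding M_minus_def using S_minus_nonempty[OF assms] by (intro Max_in) auto
  then show thesis using that by auto
qed

lemma M_zero_attained:
  assumes "pair_graph G"
  obtains A where "A \<in> S_zero G" "kernel_dim A = M_zero G"
proof -
  have "finite (kernel_dim ` S_zero G)"
    unfolding S_zero_def by (rule kernel_dim_image_finite)
  then have "M_zero G \<in> kernel_dim ` S_zero G"
    unfolding M_zero_def using S_zero_nonempty[OF assms] by (intro Max_in) auto
  then show thesis using that by auto
qed

lemma S_minus_carrier: "A \<in> S_minus G \<Longrightarrow> A \<in> carrier_mat (card (pverts G)) (card (pverts G))"
  by (simp add: S_minus_def matrix_pattern_def)

lemma M_minus_le_forcing:
  assumes G: "pair_graph G" and B: "skew_zero_forcing_set G B"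
  shows "M_minus G \<le> card B"
proof -
  interpret pair_graph G by fact
  obtain A where A: "A \<in> S_minus G" "kernel_dim A = M_minus G" by (rule M_minus_attained[OF G])
  have "A $$ (i, i) = 0" if "i < card (pverts G)" for i
  proof -
    have "transpose_mat A $$ (i, i) = (- A) $$ (i, i)" using A(1) by (simp add: S_minus_def)
    then show ?thesis using S_minus_carrier[OF A(1)] that by simp
  qed
  then show ?thesis
    using kernel_dim_le_card_forcing[of G A B] A B pair_graph_loop_free[OF G] by (simp add: S_minus_def)
qed

lemma M_zero_le_forcing:
  assumes G: "pair_graph G" and B: "skew_zero_forcing_set G B"
  shows "M_zero G \<le> card B"
proof -
  interpret pair_graph G by fact
  obtain A where A: "A \<in> S_zero G" "kernel_dim A = M_zero G" by (rule M_zero_attained[OF G])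
  then show ?thesis
    using kernel_dim_le_card_forcing[of G A B] B pair_graph_loop_free[OF G] by (simp add: S_zero_def)
qed

lemma Z_minus_attained:
  assumes "finite (pverts G)"
  obtains B where "skew_zero_forcing_set G B" "card B = Z_minus G"
proof -
  have "Z_minus G \<in> card ` {B. skew_zero_forcing_set G B}"
    unfolding Z_minus_def
    using skew_zero_forcing_sets_finite[OF assms] skew_zero_forcing_set_pverts[of G]
    by (intro Min_in) auto
  then show thesis using that by auto
qed

lemma Z_minus_le: "finite (pverts G) \<Longrightarrow> skew_zero_forcing_set G B \<Longrightarrow> Z_minus G \<le> card B"
  unfolding Z_minus_def by (intro Min_le) (auto simp: skew_zero_forcing_sets_finite)

lemma mr_minus_plus_M_minus:
  assumes G: "pair_graph G"
  shows "mr_minus G + M_minus G = card (pverts G)"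
proof -
  let ?n = "card (pverts G)"
  obtain A where A: "A \<in> S_minus G" "kernel_dim A = M_minus G" by (rule M_minus_attained[OF G])
  have rank: "vec_space.rank ?n B + kernel_dim B = ?n" if "B \<in> S_minus G" for B
    using rank_plus_kernel_dim[OF S_minus_carrier[OF that]] .
  have "mr_minus G = vec_space.rank ?n A"
    unfolding mr_minus_def
  proof (rule Min_eqI)
    show "finite (vec_space.rank ?n ` S_minus G)"
      unfolding S_minus_def by (rule rank_image_finite)
    fix k assume "k \<in> vec_space.rank ?n ` S_minus G"
    then obtain B where "B \<in> S_minus G" "k = vec_space.rank ?n B" by blast
    then show "vec_space.rank ?n A \<le> k"
      using rank[of B] rank[OF A(1)] A(2) kernel_dim_le_M_minus[of B G] by linarith
  qed (use A in auto)
  then show ?thesis using rank[OF A(1)] A(2) by simp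
qed

section \<open>Paths with a prescribed symmetric spectrum\<close>

definition discrete_inner :: "real set \<Rightarrow> real poly \<Rightarrow> real poly \<Rightarrow> real" where
  "discrete_inner L f g = (\<Sum>y\<in>L. poly f y * poly g y)"

text \<open>
  The monic polynomials orthogonal for \<open>discrete_inner L\<close>, for \<open>L\<close> symmetric about \<open>0\<close>. Symmetry is what
  makes the recurrence free of a term proportional to \<open>orth_poly L (Suc n)\<close>, and thereby makes the
  corresponding Jacobi matrix have zero diagonal.
\<close>

fun orth_poly :: "real set \<Rightarrow> nat \<Rightarrow> real poly" where
  "orth_poly L 0 = 1"
| "orth_poly L (Suc 0) = [:0, 1:]"
| "orth_poly L (Suc (Suc n)) = pCons 0 (orth_poly L (Suc n)) -
    [:discrete_inner L (orth_poly L (Suc n)) (orth_poly L (Suc n)) /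
      discrete_inner L (orth_poly L n) (orth_poly L n):] * orth_poly L n"

lemma coeff_orth_poly_above: "n < i \<Longrightarrow> Polynomial.coeff (orth_poly L n) i = 0"
  by (induction L n arbitrary: i rule: orth_poly.induct)
    (auto simp: coeff_pCons split: nat.split)

lemma coeff_orth_poly_lead: "Polynomial.coeff (orth_poly L n) n = 1"
  by (induction L n rule: orth_poly.induct) (auto simp: coeff_orth_poly_above)

lemma orth_poly_parity: "poly (orth_poly L n) (- y) = (- 1) ^ n * poly (orth_poly L n) y"
  by (induction L n rule: orth_poly.induct) (auto simp: algebra_simps)

lemma norm_orth_poly_pos:
  assumes "finite L" "n < card L"
  shows "discrete_inner L (orth_poly L n) (orth_poly L n) > 0"
proof -
  let ?q = "orth_poly L n"
  have q: "?q \<noteq> 0" using coeff_orth_poly_lead[of L n] by auto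
  have "Polynomial.degree ?q \<le> n" using coeff_orth_poly_above by (intro degree_le) auto
  then have "card {y. poly ?q y = 0} < card L" using card_poly_roots_bound[OF q] assms by linarith
  moreover have "finite {y. poly ?q y = 0}" by (rule poly_roots_finite[OF q])
  ultimately have "\<not> L \<subseteq> {y. poly ?q y = 0}" by (meson card_mono not_le)
  then obtain y where "y \<in> L" "poly ?q y \<noteq> 0" by blast
  then show ?thesis unfolding discrete_inner_def
    using sum_pos2[OF assms(1), of y "\<lambda>y. poly ?q y * poly ?q y"]
    by (simp flip: power2_eq_square)
qed

text \<open>
  The three-term recurrence, solved for the product with the variable.
\<close>

lemma shift_orth_poly:
  "\<exists>\<gamma>. (m = 0 \<longrightarrow> \<gamma> = 0) \<and>
    (\<forall>y. y * poly (orth_poly L m) y = poly (orth_poly L (Suc m)) y + \<gamma> * poly (orth_poly L (m - 1)) y)"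
proof (cases m)
  case (Suc k)
  then show ?thesis
    by (intro exI[of _ "discrete_inner L (orth_poly L m) (orth_poly L m) /
      discrete_inner L (orth_poly L k) (orth_poly L k)"]) (auto simp: algebra_simps)
qed auto

lemma sum_odd_symmetric:
  fixes g :: "real \<Rightarrow> real"
  assumes "uminus ` L = L" "\<And>y. g (- y) = - g y"
  shows "(\<Sum>y\<in>L. g y) = 0"
proof -
  have "(\<Sum>y\<in>L. g y) = (\<Sum>y\<in>uminus ` L. g y)" by (simp add: assms(1))
  also have "\<dots> = (\<Sum>y\<in>L. g (- y))" by (subst sum.reindex) auto
  also have "\<dots> = - (\<Sum>y\<in>L. g y)" by (simp add: assms(2) sum_negf)
  finally show ?thesis by simp
qed

text \<open>
  Multiplication by the variable is self-adjoint, so it can be moved onto \<open>orth_poly L m\<close>, where it produces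
  only indices next to \<open>m\<close>. The remaining product with \<open>m\<close> equal to the previous index is a sum of an
  odd function over a symmetric set.
\<close>

lemma orth_poly_orthogonal:
  assumes L: "finite L" "uminus ` L = L"
  shows "n \<le> card L \<Longrightarrow> m < n \<Longrightarrow> discrete_inner L (orth_poly L n) (orth_poly L m) = 0"
proof (induction n arbitrary: m rule: less_induct)
  case (less n)
  let ?r = "orth_poly L" and ?ip = "discrete_inner L"
  \<comment> \<open>The square of a polynomial with a parity is even, its product with the variable odd.\<close>
  have parity_zero: "?ip (pCons 0 (?r k)) (?r k) = 0" for k
    unfolding discrete_inner_def
    by (rule sum_odd_symmetric[OF L(2)]) (simp add: orth_poly_parity power_mult_distrib[symmetric] flip: power_add)
  show ?case
  proof (cases "n = 1")
    case True
    then show ?thesis using parity_zero[of 0] less.prems by (simp add: discrete_inner_def)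
  next
    case False
    then obtain k where n: "n = Suc (Suc k)" using less.prems by (metis One_nat_def less_nat_zero_code old.nat.exhaust)
    define d where "d = ?ip (?r (Suc k)) (?r (Suc k)) / ?ip (?r k) (?r k)"
    obtain \<gamma> where \<gamma>: "m = 0 \<longrightarrow> \<gamma> = 0"
      "\<And>y. y * poly (?r m) y = poly (?r (Suc m)) y + \<gamma> * poly (?r (m - 1)) y"
      using shift_orth_poly[of m L] by blast
    have "?ip (?r n) (?r m) = (\<Sum>y\<in>L. poly (?r (Suc k)) y * (y * poly (?r m) y)) - d * ?ip (?r k) (?r m)"
    proof -
      have "poly (?r n) y = y * poly (?r (Suc k)) y - d * poly (?r k) y" for y
        by (simp add: n d_def)
      then have "?ip (?r n) (?r m) =
          (\<Sum>y\<in>L. poly (?r (Suc k)) y * (y * poly (?r m) y) - d * (poly (?r k) y * poly (?r m) y))"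
        unfolding discrete_inner_def[of L "?r n"] by (intro sum.cong refl) (simp only: left_diff_distrib right_diff_distrib mult_ac)
      then show ?thesis
        by (simp add: sum_subtractf sum_distrib_left discrete_inner_def[of L "?r k" "?r m"])
    qed
    moreover have "(\<Sum>y\<in>L. poly (?r (Suc k)) y * (y * poly (?r m) y)) =
        ?ip (?r (Suc k)) (?r (Suc m)) + \<gamma> * ?ip (?r (Suc k)) (?r (m - 1))"
      unfolding \<gamma>(2) by (simp add: discrete_inner_def algebra_simps sum.distrib sum_distrib_left)
    moreover consider "m = Suc k" | "m = k" | "m < k" using less.prems n by linarith
    then have "(\<Sum>y\<in>L. poly (?r (Suc k)) y * (y * poly (?r m) y)) = d * ?ip (?r k) (?r m)"
    proof cases
      case 1
      have "?ip (?r k) (?r (Suc k)) = ?ip (?r (Suc k)) (?r k)"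
        by (simp add: discrete_inner_def mult.commute)
      also have "\<dots> = 0" using less.IH[of "Suc k" k] less.prems n by simp
      finally show ?thesis using parity_zero[of "Suc k"] 1
        by (simp add: discrete_inner_def mult_ac)
    next
      case 2
      have "\<gamma> * ?ip (?r (Suc k)) (?r (m - 1)) = 0"
        using \<gamma>(1) less.IH[of "Suc k" "m - 1"] less.prems n 2 by (cases "m = 0") auto
      then show ?thesis
        using calculation(2) 2 norm_orth_poly_pos[OF L(1), of k] less.prems n by (simp add: d_def)
    next
      case 3
      then show ?thesis
        using calculation(2) less.IH[of "Suc k" "Suc m"] less.IH[of "Suc k" "m - 1"] less.IH[of k m]
          less.prems n by simp
    qed
    ultimately show ?thesis by simp
  qed
qed

text \<open>
  The last polynomial is orthogonal to all polynomials of degree below \<open>card L\<close>. Subtracting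
  \<open>\<Prod>z\<in>L. (X - z)\<close> brings it into that range without changing its values on \<open>L\<close>, so it is orthogonal to
  itself on \<open>L\<close>.
\<close>

lemma orth_poly_vanishes:
  assumes L: "finite L" "uminus ` L = L" and "y \<in> L"
  shows "poly (orth_poly L (card L)) y = 0"
proof -
  let ?r = "orth_poly L (card L)" and ?ip = "discrete_inner L"
  have orth: "?ip ?r q = 0" if "d \<le> card L" "\<And>i. d \<le> i \<Longrightarrow> Polynomial.coeff q i = 0" for d q
    using that
  proof (induction d arbitrary: q)
    case 0
    then have "q = 0" by (simp add: poly_eq_iff)
    then show ?case by (simp add: discrete_inner_def)
  next
    case (Suc d)
    define q' where "q' = q - [:Polynomial.coeff q d:] * orth_poly L d"
    have "Polynomial.coeff q' i = 0" if "d \<le> i" for i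
      using Suc.prems(2)[of i] that
      by (cases "i = d") (auto simp: q'_def coeff_orth_poly_lead coeff_orth_poly_above)
    then have "?ip ?r q' = 0" using Suc by simp
    moreover have "?ip ?r q' = ?ip ?r q - Polynomial.coeff q d * ?ip ?r (orth_poly L d)"
      by (simp add: q'_def discrete_inner_def algebra_simps sum_subtractf sum_distrib_left)
    ultimately show ?case using orth_poly_orthogonal[OF L, of "card L" d] Suc.prems(1) by simp
  qed
  let ?P = "\<Prod>z\<in>L. [:- z, 1:]"
  have deg: "Polynomial.degree ?P = card L"
    by (subst degree_prod_eq_sum_degree) auto
  have lead: "Polynomial.coeff ?P (card L) = 1"
    using lead_coeff_prod[of "\<lambda>z. [:- z, 1:]" L] unfolding deg by simp
  have P0: "poly ?P z = 0" if "z \<in> L" for z using that L(1) by (auto simp: poly_prod)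
  have "?ip ?r (?r - ?P) = 0"
  proof (rule orth[OF order_refl])
    fix i assume "card L \<le> i"
    then show "Polynomial.coeff (?r - ?P) i = 0"
      using lead coeff_orth_poly_lead[of L "card L"] coeff_orth_poly_above[of "card L" i L]
        coeff_eq_0[of ?P i] deg by (cases "i = card L") auto
  qed
  moreover have "?ip ?r (?r - ?P) = ?ip ?r ?r"
    unfolding discrete_inner_def using P0 by (intro sum.cong) auto
  ultimately have "(\<Sum>z\<in>L. (poly ?r z)\<^sup>2) = 0" by (simp add: discrete_inner_def power2_eq_square)
  then show ?thesis using assms by (simp add: sum_nonneg_eq_0_iff)
qed

text \<open>
  Let \<open>J\<close> be the symmetric matrix of the path whose edge from \<open>i\<close> to \<open>i + 1\<close> has weight \<open>h i\<close>, and \<open>H\<close>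
  the diagonal matrix of the \<open>h i\<close>. The equations say \<open>J r = y H r\<close> for \<open>r = (r 0 y, r 1 y, ...)\<close>: the
  pencil of \<open>J\<close> and \<open>H\<close> has spectrum \<open>L\<close>. Allowing \<open>H\<close> besides the identity saves taking square
  roots: \<open>h i\<close> is the reciprocal of the squared norm of the \<open>i\<close>-th orthogonal polynomial.
\<close>

lemma jacobi_weights_exist:
  assumes L: "finite L" "uminus ` L = L"
  obtains h :: "nat \<Rightarrow> real" and r :: "nat \<Rightarrow> real \<Rightarrow> real" where
    "\<And>i. i < card L \<Longrightarrow> h i > 0"
    "\<And>y. r 0 y = 1"
    "\<And>y. y \<in> L \<Longrightarrow> r (card L) y = 0"
    "\<And>i y. i < card L \<Longrightarrow>
      h i * r (Suc i) y + (if i = 0 then 0 else h (i - 1) * r (i - 1) y) = h i * (y * r i y)"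
proof
  let ?N = "\<lambda>i. discrete_inner L (orth_poly L i) (orth_poly L i)"
  let ?h = "\<lambda>i. 1 / ?N i" and ?r = "\<lambda>i. poly (orth_poly L i)"
  show "?h i > 0" if "i < card L" for i using norm_orth_poly_pos[OF L(1) that] by simp
  show "?r 0 y = 1" for y by simp
  show "?r (card L) y = 0" if "y \<in> L" for y by (rule orth_poly_vanishes[OF L that])
  show "?h i * ?r (Suc i) y + (if i = 0 then 0 else ?h (i - 1) * ?r (i - 1) y) = ?h i * (y * ?r i y)"
    if "i < card L" for i y
  proof (cases i)
    case (Suc k)
    have "?N i \<noteq> 0" "?N k \<noteq> 0"
      using norm_orth_poly_pos[OF L(1), of i] norm_orth_poly_pos[OF L(1), of k] that Suc by simp_all
    then show ?thesis by (simp add: Suc field_simps)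
  qed simp
qed

text \<open>
  The coefficients of the Lagrange basis polynomials invert the Vandermonde matrix of \<open>S\<close>.
\<close>

lemma dual_vandermonde:
  fixes S :: "'a :: field set"
  assumes "finite S"
  obtains w :: "'a \<Rightarrow> nat \<Rightarrow> 'a" where
    "\<And>t j. j < card S \<Longrightarrow> (\<Sum>z\<in>S. w z t * z ^ j) = (if j = t then 1 else 0)"
proof -
  define l where "l z = (\<Prod>u\<in>S - {z}. [:inverse (z - u):] * [:- u, 1:])" for z
  have deg_l: "Polynomial.degree (l z) < card S" if "z \<in> S" for z
  proof -
    have "Polynomial.degree (l z) \<le> (\<Sum>u\<in>S - {z}. Polynomial.degree ([:inverse (z - u):] * [:- u, 1:]))"
      unfolding l_def by (rule degree_prod_sum_le[OF finite_Diff[OF assms], unfolded comp_def])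
    also have "\<dots> \<le> (\<Sum>u\<in>S - {z}. 1)" by (intro sum_mono) simp
    also have "\<dots> < card S" using that assms card_gt_0_iff[of S] by auto
    finally show ?thesis .
  qed
  have l: "poly (l z) u = (if u = z then 1 else 0)" if "z \<in> S" "u \<in> S" for z u
  proof -
    have "poly (l z) u = (\<Prod>v\<in>S - {z}. inverse (z - v) * (u - v))"
      by (simp add: l_def poly_prod algebra_simps)
    also have "\<dots> = (if u = z then 1 else 0)"
    proof (cases "u = z")
      case True
      then have "(\<Prod>v\<in>S - {z}. inverse (z - v) * (u - v)) = 1"
        by (intro prod.neutral ballI, simp) (metis left_inverse right_minus_eq)
      then show ?thesis using True by simp
    qed (use that assms in auto)
    finally show ?thesis .
  qed
  have interp: "(\<Sum>z\<in>S. [:z ^ j:] * l z) = Polynomial.monom 1 j" if "j < card S" for j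
  proof (rule ccontr)
    let ?q = "(\<Sum>z\<in>S. [:z ^ j:] * l z) - Polynomial.monom 1 j"
    assume "\<not> ?thesis"
    then have q: "?q \<noteq> 0" by simp
    have "Polynomial.degree ?q < card S"
    proof (rule degree_diff_less)
      show "Polynomial.degree (\<Sum>z\<in>S. [:z ^ j:] * l z) < card S"
        using that deg_l
        by (intro degree_sum_less) (auto intro: le_less_trans[OF degree_smult_le])
      show "Polynomial.degree (Polynomial.monom (1 :: 'a) j) < card S"
        using that by (simp add: degree_monom_eq)
    qed
    moreover have "S \<subseteq> {u. poly ?q u = 0}"
    proof
      fix u assume u: "u \<in> S"
      have "(\<Sum>z\<in>S. poly ([:z ^ j:] * l z) u) = (\<Sum>z\<in>S. if z = u then u ^ j else 0)"
        using u l by (intro sum.cong) auto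
      then show "u \<in> {u. poly ?q u = 0}" using u assms by (simp add: poly_sum poly_monom)
    qed
    then have "card S \<le> card {u. poly ?q u = 0}" by (rule card_mono[OF poly_roots_finite[OF q]])
    ultimately show False using card_poly_roots_bound[OF q] by linarith
  qed
  show thesis
  proof (rule that[of "\<lambda>z t. Polynomial.coeff (l z) t"])
    fix t j assume j: "j < card S"
    have "(\<Sum>z\<in>S. Polynomial.coeff (l z) t * z ^ j) = Polynomial.coeff (\<Sum>z\<in>S. [:z ^ j:] * l z) t"
      by (simp add: coeff_sum mult.commute)
    then show "(\<Sum>z\<in>S. Polynomial.coeff (l z) t * z ^ j) = (if j = t then 1 else 0)"
      unfolding interp[OF j] by simp
  qed
qed

section \<open>Matrices of the cylinder with many null vectors\<close>

text \<open>
  The parameter \<open>\<sigma>\<close> is \<open>1\<close> for symmetric and \<open>- 1\<close> for skew-symmetric matrices.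
\<close>

definition path_weight :: "(nat \<Rightarrow> real) \<Rightarrow> real \<Rightarrow> nat \<Rightarrow> nat \<Rightarrow> real" where
  "path_weight h \<sigma> i k = (if k = Suc i then h i else if i = Suc k then \<sigma> * h k else 0)"

text \<open>
  The edge that closes the cycle carries the sign \<open>\<epsilon>\<close>, so that the eigenvectors are built from the
  solutions of \<open>z ^ c = \<epsilon>\<close>.
\<close>

definition cycle_weight :: "nat \<Rightarrow> real \<Rightarrow> real \<Rightarrow> nat \<Rightarrow> nat \<Rightarrow> real" where
  "cycle_weight c \<sigma> \<epsilon> j l =
    (if l = Suc j then 1 else if j = Suc l then \<sigma>
     else if j = c - 1 \<and> l = 0 then \<epsilon> else if j = 0 \<and> l = c - 1 then \<sigma> * \<epsilon> else 0)"

text \<open>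
  The factor \<open>h\<close> in front of the cycle is the diagonal matrix of the pencil in
  \<open>jacobi_weights_exist\<close>.
\<close>

definition cylinder_weight ::
    "nat \<Rightarrow> (nat \<Rightarrow> real) \<Rightarrow> real \<Rightarrow> real \<Rightarrow> nat \<times> nat \<Rightarrow> nat \<times> nat \<Rightarrow> real" where
  "cylinder_weight c h \<sigma> \<epsilon> u v =
    (if snd u = snd v then path_weight h \<sigma> (fst u) (fst v) else 0) +
    (if fst u = fst v then h (fst u) * cycle_weight c \<sigma> \<epsilon> (snd u) (snd v) else 0)"

lemma path_weight_apply:
  fixes x :: "nat \<Rightarrow> 'a :: real_algebra_1"
  assumes "i < p" "x p = 0"
  shows "(\<Sum>k<p. of_real (path_weight h \<sigma> i k) * x k) =
    of_real (h i) * x (Suc i) + (if i = 0 then 0 else of_real (\<sigma> * h (i - 1)) * x (i - 1))"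
proof -
  have "(\<Sum>k<p. of_real (path_weight h \<sigma> i k) * x k) =
      (\<Sum>k<p. (if k = Suc i then of_real (h i) * x (Suc i) else 0) +
        (if i \<noteq> 0 \<and> k = i - 1 then of_real (\<sigma> * h (i - 1)) * x (i - 1) else 0))"
    by (intro sum.cong) (auto simp: path_weight_def)
  also have "\<dots> = (if Suc i < p then of_real (h i) * x (Suc i) else 0) +
      (if i = 0 then 0 else of_real (\<sigma> * h (i - 1)) * x (i - 1))"
    using assms by (auto simp: sum.distrib)
  also have "(if Suc i < p then of_real (h i) * x (Suc i) else 0) = of_real (h i) * x (Suc i)"
    using assms by (cases "Suc i = p") auto
  finally show ?thesis .
qed

lemma cycle_weight_apply:
  fixes z :: complex
  assumes "j < c" "c \<ge> 3" and z: "z ^ c = of_real \<epsilon>" and \<epsilon>: "\<epsilon> * \<epsilon> = 1"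
  shows "(\<Sum>l<c. of_real (cycle_weight c \<sigma> \<epsilon> j l) * z ^ l) = (z + of_real \<sigma> / z) * z ^ j"
proof -
  have z0: "z \<noteq> 0" using z \<epsilon> assms(2) by (auto simp: power_0_left split: if_splits)
  obtain d where d: "c = Suc d" using assms(1) by (cases c) auto
  define up down where "up = (if Suc j < c then Suc j else 0)" and "down = (if j = 0 then d else j - 1)"
  have bounds: "up < c" "down < c" using assms(1,2) d by (auto simp: up_def down_def)
  have "(\<Sum>l<c. of_real (cycle_weight c \<sigma> \<epsilon> j l) * z ^ l) =
      (\<Sum>l<c. (if l = up then (if Suc j < c then z ^ Suc j else of_real \<epsilon>) else 0) +
        (if l = down then (if j = 0 then of_real (\<sigma> * \<epsilon>) * z ^ d else of_real \<sigma> * z ^ (j - 1)) else 0))"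
    using assms(1,2) d by (intro sum.cong refl) (auto simp: cycle_weight_def up_def down_def)
  also have "\<dots> = (if Suc j < c then z ^ Suc j else of_real \<epsilon>) +
      (if j = 0 then of_real (\<sigma> * \<epsilon>) * z ^ d else of_real \<sigma> * z ^ (j - 1))"
    using bounds by (simp add: sum.distrib)
  also have "(if Suc j < c then z ^ Suc j else of_real \<epsilon>) = z * z ^ j"
    using assms(1) z by (cases "Suc j = c") auto
  also have "(if j = 0 then of_real (\<sigma> * \<epsilon>) * z ^ d else of_real \<sigma> * z ^ (j - 1)) = of_real \<sigma> / z * z ^ j"
  proof (cases j)
    case 0
    have "of_real \<epsilon> * z ^ d * z = of_real \<epsilon> * z ^ c" by (simp add: d)
    also have "\<dots> = 1" using z \<epsilon> by (metis of_real_1 of_real_mult)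
    finally show ?thesis using z0 0 by (simp add: field_simps)
  qed (use z0 in auto)
  finally show ?thesis by (simp add: algebra_simps)
qed

lemma cylinder_weight_support:
  assumes "c \<ge> 3" "\<sigma> \<noteq> 0" "\<epsilon> \<noteq> 0" "\<And>i. i < p \<Longrightarrow> h i \<noteq> 0"
    and "u \<in> pverts (cylinder p c)" "v \<in> pverts (cylinder p c)"
  shows "cylinder_weight c h \<sigma> \<epsilon> u v \<noteq> 0 \<longleftrightarrow> (u, v) \<in> parcs (cylinder p c)"
proof -
  obtain i j k l where [simp]: "u = (i, j)" "v = (k, l)" by (cases u, cases v) auto
  have b: "i < p" "j < c" "k < p" "l < c" using assms(5,6) by (auto simp: pverts_cylinder)
  have P: "path_weight h \<sigma> i k \<noteq> 0 \<longleftrightarrow> k = Suc i \<or> i = Suc k"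
    using assms(2,4) b by (auto simp: path_weight_def)
  have C: "cycle_weight c \<sigma> \<epsilon> j l \<noteq> 0 \<longleftrightarrow> l = Suc j mod c \<or> j = Suc l mod c"
  proof -
    have "Suc m mod c = (if m = c - 1 then 0 else Suc m)" if "m < c" for m
      using that by (cases "Suc m = c") auto
    note wrap = this[OF b(2)] this[OF b(4)]
    have "cycle_weight c \<sigma> \<epsilon> j l \<noteq> 0 \<longleftrightarrow>
        l = Suc j \<or> j = Suc l \<or> (j = c - 1 \<and> l = 0) \<or> (j = 0 \<and> l = c - 1)"
      using assms(2,3) by (simp add: cycle_weight_def)
    also have "\<dots> \<longleftrightarrow> l = Suc j mod c \<or> j = Suc l mod c"
      unfolding wrap using assms(1) b by auto
    finally show ?thesis .
  qed
  have "cycle_weight c \<sigma> \<epsilon> j j = 0" using assms(1) b by (auto simp: cycle_weight_def)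
  moreover have "path_weight h \<sigma> i i = 0" by (simp add: path_weight_def)
  ultimately show ?thesis
    using b assms(4)[of i] P C by (auto simp: cylinder_weight_def parcs_cylinder)
qed

lemma cylinder_weight_swap:
  assumes "c \<ge> 3" "\<sigma> * \<sigma> = 1"
  shows "cylinder_weight c h \<sigma> \<epsilon> v u = \<sigma> * cylinder_weight c h \<sigma> \<epsilon> u v"
proof -
  have s: "\<sigma> * (\<sigma> * x) = x" for x using assms(2) by (simp flip: mult.assoc)
  have P: "path_weight h \<sigma> k i = \<sigma> * path_weight h \<sigma> i k" for i k
    by (auto simp: path_weight_def s)
  have C: "cycle_weight c \<sigma> \<epsilon> l j = \<sigma> * cycle_weight c \<sigma> \<epsilon> j l" for j l
    using assms by (auto simp: cycle_weight_def s)
  show ?thesis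
    unfolding cylinder_weight_def P[of "fst v" "fst u"] C[of "snd v" "snd u"]
    by (auto simp: algebra_simps)
qed

text \<open>
  The passage from weights and null vectors indexed by vertices to matrices: the points \<open>b t\<close> witness that
  the vectors \<open>x t\<close> are independent.
\<close>

lemma weights_realised:
  fixes a :: "'v \<Rightarrow> 'v \<Rightarrow> real"
  assumes G: "finite (pverts G)"
    and a: "\<And>u v. u \<in> pverts G \<Longrightarrow> v \<in> pverts G \<Longrightarrow> a u v \<noteq> 0 \<longleftrightarrow> (u, v) \<in> parcs G"
    and T: "finite T" "\<And>t u. t \<in> T \<Longrightarrow> u \<in> pverts G \<Longrightarrow> (\<Sum>v\<in>pverts G. a u v * x t v) = 0"
      "\<And>t. t \<in> T \<Longrightarrow> b t \<in> pverts G"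
      "\<And>t u. t \<in> T \<Longrightarrow> u \<in> T \<Longrightarrow> x t (b u) = (if u = t then 1 else 0)"
  obtains f where "bij_betw f {..<card (pverts G)} (pverts G)"
    "matrix_pattern G (mat (card (pverts G)) (card (pverts G)) (\<lambda>(i, j). a (f i) (f j)))"
    "card T \<le> kernel_dim (mat (card (pverts G)) (card (pverts G)) (\<lambda>(i, j). a (f i) (f j)))"
proof -
  let ?n = "card (pverts G)"
  obtain f where f: "bij_betw f {..<?n} (pverts G)"
    using ex_bij_betw_nat_finite[OF G] by (auto simp: atLeast0LessThan)
  have fv: "f i \<in> pverts G" if "i < ?n" for i using f that by (auto dest: bij_betwE)
  let ?A = "mat ?n ?n (\<lambda>(i, j). a (f i) (f j))"
  have A: "?A \<in> carrier_mat ?n ?n" by simp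
  have pat: "matrix_pattern G ?A"
    unfolding matrix_pattern_def using f a fv
    by (intro conjI exI[of _ f]) (auto simp: atLeast0LessThan)
  have null: "null_vector ?n ?A (\<lambda>i. x t (f i))" if "t \<in> T" for t
    unfolding null_vector_def
  proof (intro allI impI)
    fix i assume i: "i < ?n"
    have "(\<Sum>j<?n. ?A $$ (i, j) * x t (f j)) = (\<Sum>j<?n. a (f i) (f j) * x t (f j))"
      using i by (intro sum.cong) auto
    also have "\<dots> = (\<Sum>v\<in>pverts G. a (f i) v * x t v)" by (rule sum.reindex_bij_betw[OF f])
    also have "\<dots> = 0" using T(2) that fv i by simp
    finally show "(\<Sum>j<?n. ?A $$ (i, j) * x t (f j)) = 0" .
  qed
  define g where "g = inv_into {..<?n} f"
  have g: "g v < ?n" "f (g v) = v" if "v \<in> pverts G" for v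
    using f that bij_betw_apply[OF bij_betw_inv_into[OF f]] by (auto simp: g_def bij_betw_inv_into_right)
  have "card T \<le> kernel_dim ?A"
    by (rule kernel_dim_ge[OF A T(1), of "\<lambda>t i. x t (f i)" "\<lambda>t. g (b t)"]) (use null g T in auto)
  then show thesis using that f pat by blast
qed

text \<open>
  For \<open>z\<close> in \<open>S\<close> with partner \<open>y\<close> in \<open>L\<close>, the complex vector \<open>s ^ i * r i y * z ^ j\<close> is a null vector: the
  factor \<open>s ^ i\<close> with \<open>s\<^sup>2 = \<sigma>\<close> turns the symmetric path into one of the required symmetry type, with
  eigenvalue \<open>s y\<close>, which cancels the eigenvalue \<open>z + \<sigma> / z\<close> of the cycle. On the first layer these
  vectors are the geometric sequences \<open>z ^ j\<close>, so by \<open>dual_vandermonde\<close> suitable combinations are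
  unit vectors on the first \<open>card S\<close> vertices of that layer. The weights are real, so real parts of null
  vectors are null vectors; this yields as many independent real null vectors.
\<close>

lemma cylinder_matrix_exists:
  fixes s :: complex and S :: "complex set"
  assumes p: "p \<ge> 1" and c: "c \<ge> 3" and \<sigma>: "\<sigma> * \<sigma> = 1" and \<epsilon>: "\<epsilon> * \<epsilon> = (1 :: real)"
    and s: "s * s = of_real \<sigma>"
    and L: "finite L" "uminus ` L = L" "card L = p"
    and S: "\<And>z. z \<in> S \<Longrightarrow> z ^ c = of_real \<epsilon>"
      "\<And>z. z \<in> S \<Longrightarrow> \<exists>y\<in>L. z + of_real \<sigma> / z = - (s * of_real y)"
  obtains A where "matrix_pattern (cylinder p c) A" "transpose_mat A = \<sigma> \<cdot>\<^sub>m A"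
    "\<And>i. i < card (pverts (cylinder p c)) \<Longrightarrow> A $$ (i, i) = 0" "card S \<le> kernel_dim A"
proof -
  let ?V = "pverts (cylinder p c)"
  have fin: "finite ?V" by (simp add: pverts_cylinder)
  obtain h r where h: "\<And>i. i < card L \<Longrightarrow> h i > 0" and r0: "\<And>y. r 0 y = 1"
    and rp: "\<And>y. y \<in> L \<Longrightarrow> r (card L) y = 0"
    and rec: "\<And>i y. i < card L \<Longrightarrow>
      h i * r (Suc i) y + (if i = 0 then 0 else h (i - 1) * r (i - 1) y) = h i * (y * r i y)"
    using jacobi_weights_exist[OF L(1,2)] by blast
  let ?a = "cylinder_weight c h \<sigma> \<epsilon>"
  have nz: "\<sigma> \<noteq> 0" "\<epsilon> \<noteq> 0" using \<sigma> \<epsilon> by auto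
  have hnz: "h i \<noteq> 0" if "i < p" for i using h[of i] L(3) that by simp
  have S_sub: "S \<subseteq> {z. z ^ c = of_real \<epsilon>}" using S(1) by auto
  have finS: "finite S" and cardS: "card S \<le> c"
    using finite_subset[OF S_sub] card_mono[OF _ S_sub] finite_nth_roots[of c "of_real \<epsilon>"]
      card_nth_roots[of "of_real \<epsilon>" c] nz c by simp_all
  obtain lam where lam: "\<And>z. z \<in> S \<Longrightarrow> lam z \<in> L"
    "\<And>z. z \<in> S \<Longrightarrow> z + of_real \<sigma> / z = - (s * of_real (lam z))"
    using S(2) by metis
  define X where "X z v = s ^ fst v * of_real (r (fst v) (lam z)) * z ^ snd v" for z v
  have X_null: "(\<Sum>v\<in>?V. of_real (?a u v) * X z v) = 0" if z: "z \<in> S" and u: "u \<in> ?V" for z u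
  proof -
    obtain i j where uij: "u = (i, j)" "i < p" "j < c" using u by (auto simp: pverts_cylinder)
    \<comment> \<open>The layer \<open>p\<close> beyond the last one vanishes since \<open>r p\<close> vanishes on \<open>L\<close>; it may thus be kept in
      the sum over the neighbouring layers.\<close>
    have Xp: "X z (p, j) = 0" using rp[OF lam(1)[OF z]] L(3) by (simp add: X_def)
    have "(\<Sum>v\<in>?V. of_real (?a u v) * X z v) =
        (\<Sum>k<p. \<Sum>l<c. (if j = l then of_real (path_weight h \<sigma> i k) * X z (k, l) else 0) +
          (if i = k then of_real (h i * cycle_weight c \<sigma> \<epsilon> j l) * X z (k, l) else 0))"
      unfolding pverts_cylinder sum.cartesian_product
      by (intro sum.cong) (auto simp: uij cylinder_weight_def algebra_simps)
    also have "\<dots> = (\<Sum>k<p. of_real (path_weight h \<sigma> i k) * X z (k, j)) +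
        (\<Sum>k<p. if i = k then \<Sum>l<c. of_real (h i * cycle_weight c \<sigma> \<epsilon> j l) * X z (k, l) else 0)"
      unfolding sum.distrib using uij
      by (intro arg_cong2[of _ _ _ _ "(+)"] sum.cong) auto
    also have "\<dots> = (\<Sum>k<p. of_real (path_weight h \<sigma> i k) * X z (k, j)) +
        of_real (h i) * s ^ i * of_real (r i (lam z)) * (\<Sum>l<c. of_real (cycle_weight c \<sigma> \<epsilon> j l) * z ^ l)"
      using uij by (simp add: X_def sum_distrib_left mult_ac)
    also have "\<dots> = of_real (h i) * X z (Suc i, j) +
        (if i = 0 then 0 else of_real (\<sigma> * h (i - 1)) * X z (i - 1, j)) +
        of_real (h i) * s ^ i * of_real (r i (lam z)) * (- (s * of_real (lam z)) * z ^ j)"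
      unfolding cycle_weight_apply[OF uij(3) c S(1)[OF z] \<epsilon>] lam(2)[OF z]
      by (subst path_weight_apply[OF uij(2), of "\<lambda>k. X z (k, j)"]) (use Xp in auto)
    also have "(if i = 0 then 0 else of_real (\<sigma> * h (i - 1)) * X z (i - 1, j)) =
        s ^ Suc i * z ^ j * of_real (if i = 0 then 0 else h (i - 1) * r (i - 1) (lam z))"
      by (cases i) (auto simp: X_def s[symmetric])
    also have "of_real (h i) * X z (Suc i, j) +
        s ^ Suc i * z ^ j * of_real (if i = 0 then 0 else h (i - 1) * r (i - 1) (lam z)) +
        of_real (h i) * s ^ i * of_real (r i (lam z)) * (- (s * of_real (lam z)) * z ^ j) =
        s ^ Suc i * z ^ j * of_real ((h i * r (Suc i) (lam z) +
          (if i = 0 then 0 else h (i - 1) * r (i - 1) (lam z))) - h i * (lam z * r i (lam z)))"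
      by (simp add: X_def algebra_simps)
    also have "\<dots> = 0" using rec[of i "lam z"] uij L(3) by simp
    finally show ?thesis .
  qed
  obtain w where w: "\<And>t j. j < card S \<Longrightarrow> (\<Sum>z\<in>S. w z t * z ^ j) = (if j = t then 1 else 0)"
    using dual_vandermonde[OF finS] by blast
  define x where "x t v = Re (\<Sum>z\<in>S. w z t * X z v)" for t v
  have x_null: "(\<Sum>v\<in>?V. ?a u v * x t v) = 0" if u: "u \<in> ?V" for t u
  proof -
    have "(\<Sum>v\<in>?V. ?a u v * x t v) = Re (\<Sum>v\<in>?V. of_real (?a u v) * (\<Sum>z\<in>S. w z t * X z v))"
      by (simp add: x_def)
    also have "(\<Sum>v\<in>?V. of_real (?a u v) * (\<Sum>z\<in>S. w z t * X z v)) =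
        (\<Sum>z\<in>S. w z t * (\<Sum>v\<in>?V. of_real (?a u v) * X z v))"
      unfolding sum_distrib_left by (subst sum.swap) (simp add: mult_ac)
    also have "\<dots> = 0" using X_null[OF _ u] by simp
    finally show ?thesis by simp
  qed
  have dual: "x t (0, j) = (if j = t then 1 else 0)" if "j < card S" for t j
    using w[OF that, of t] by (simp add: x_def X_def r0)
  obtain f where f: "bij_betw f {..<card ?V} ?V"
    "matrix_pattern (cylinder p c) (mat (card ?V) (card ?V) (\<lambda>(i, j). ?a (f i) (f j)))"
    "card {..<card S} \<le> kernel_dim (mat (card ?V) (card ?V) (\<lambda>(i, j). ?a (f i) (f j)))"
  proof (rule weights_realised[OF fin, of ?a "{..<card S}" x "\<lambda>t. (0, t)"])
    show "?a u v \<noteq> 0 \<longleftrightarrow> (u, v) \<in> parcs (cylinder p c)" if "u \<in> ?V" "v \<in> ?V" for u v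
      by (rule cylinder_weight_support[OF c nz hnz that])
    show "(0, t) \<in> ?V" if "t \<in> {..<card S}" for t using that cardS p by (auto simp: pverts_cylinder)
  qed (use x_null dual in auto)
  have fv: "f i \<in> ?V" if "i < card ?V" for i using f(1) that by (auto dest: bij_betwE)
  show thesis
  proof (rule that[OF f(2)])
    show "transpose_mat (mat (card ?V) (card ?V) (\<lambda>(i, j). ?a (f i) (f j))) =
        \<sigma> \<cdot>\<^sub>m mat (card ?V) (card ?V) (\<lambda>(i, j). ?a (f i) (f j))"
      by (rule eq_matI) (auto intro: cylinder_weight_swap[OF c \<sigma>])
    show "mat (card ?V) (card ?V) (\<lambda>(i, j). ?a (f i) (f j)) $$ (i, i) = 0" if "i < card ?V" for i
    proof -
      have "(f i, f i) \<notin> parcs (cylinder p c)"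
        using pair_graph_loop_free[OF pair_graph_cylinder[OF c]] by blast
      then show ?thesis
        using cylinder_weight_support[OF c nz hnz fv[OF that] fv[OF that]] that by auto
    qed
  qed (use f(3) in simp)
qed

section \<open>Symmetric sets of reals and roots of unity\<close>

lemma card_symmetric_even:
  fixes V :: "real set"
  assumes "finite V" "uminus ` V = V" "0 \<notin> V"
  shows "even (card V)"
proof -
  let ?P = "{y \<in> V. y > 0}"
  have neg: "- y \<in> V" if "y \<in> V" for y using assms(2) that by blast
  have "V = ?P \<union> uminus ` ?P"
  proof (intro equalityI subsetI)
    fix y assume y: "y \<in> V"
    then have "y > 0 \<or> - y > 0" using assms(3) by (metis linorder_neqE neg_0_less_iff_less)
    then show "y \<in> ?P \<union> uminus ` ?P" using y neg[OF y] by (metis (mono_tags, lifting) UnI1 UnI2 image_eqI mem_Collect_eq minus_minus)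
  qed (use neg in auto)
  moreover have "?P \<inter> uminus ` ?P = {}" by auto
  ultimately have "card V = card ?P + card (uminus ` ?P)"
    using assms(1) by (metis (no_types, lifting) card_Un_disjoint finite_Un)
  also have "card (uminus ` ?P) = card ?P" by (simp add: card_image)
  finally show ?thesis by simp
qed

text \<open>
  Removing a pair \<open>{y, - y}\<close> with \<open>y \<noteq> 0\<close> keeps the symmetry, and the parity condition lets such
  steps end at cardinality \<open>p\<close> exactly.
\<close>

lemma symmetric_set_shrink:
  fixes V :: "real set"
  assumes "finite V" "uminus ` V = V" "p \<le> card V" "even (card V + p)"
  shows "\<exists>L \<subseteq> V. uminus ` L = L \<and> card L = p"
  using assms
proof (induction "card V" arbitrary: V rule: less_induct)
  case less
  show ?case
  proof (cases "card V = p")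
    case True
    then show ?thesis using less.prems by blast
  next
    case False
    have big: "p + 2 \<le> card V"
    proof (rule ccontr)
      assume "\<not> p + 2 \<le> card V"
      then have "card V = Suc p" using False less.prems(3) by linarith
      then show False using less.prems(4) by simp
    qed
    have "\<not> V \<subseteq> {0}" using big card_mono[of "{0}" V] by auto
    then obtain y where y: "y \<in> V" "y \<noteq> 0" by blast
    have neg: "- u \<in> V" if "u \<in> V" for u using less.prems(2) that by blast
    let ?V = "V - {y, - y}"
    have "card ?V = card V - card {y, - y}"
      using y neg[OF y(1)] by (intro card_Diff_subset) auto
    also have "card {y, - y} = 2" using y(2) by simp
    finally have card: "card ?V = card V - 2" .
    have "\<exists>L \<subseteq> ?V. uminus ` L = L \<and> card L = p"
    proof (rule less.hyps)
      show "uminus ` ?V = ?V"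
      proof (intro equalityI subsetI)
        fix u assume "u \<in> ?V"
        then have "- u \<in> ?V" using neg by auto
        then show "u \<in> uminus ` ?V" by (metis image_eqI minus_minus)
      qed (use neg in auto)
    qed (use card big less.prems in auto)
    then show ?thesis by blast
  qed
qed

lemma symmetric_set_grow:
  fixes V :: "real set"
  assumes "finite V" "uminus ` V = V" "card V \<le> p" "even (card V + p)"
  shows "\<exists>L. V \<subseteq> L \<and> finite L \<and> uminus ` L = L \<and> card L = p"
  using assms
proof (induction "p - card V" arbitrary: V rule: less_induct)
  case less
  show ?case
  proof (cases "card V = p")
    case True
    then show ?thesis using less.prems by blast
  next
    case False
    have big: "card V + 2 \<le> p"
    proof (rule ccontr)
      assume "\<not> card V + 2 \<le> p"
      then have "p = Suc (card V)" using False less.prems(3) by linarith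
      then show False using less.prems(4) by simp
    qed
    have "infinite ({0<..} - V)" using less.prems(1) infinite_Ioi by (simp add: infinite_Ioi Diff_infinite_finite)
    then obtain y where y: "y > 0" "y \<notin> V"
      by (metis DiffE all_not_in_conv finite.emptyI greaterThan_iff)
    have ny: "- y \<notin> V" using less.prems(2) y(2) by (metis image_eqI minus_minus)
    let ?V = "insert y (insert (- y) V)"
    have card: "card ?V = card V + 2" using less.prems(1) y ny by simp
    have "\<exists>L. ?V \<subseteq> L \<and> finite L \<and> uminus ` L = L \<and> card L = p"
    proof (rule less.hyps)
      show "uminus ` ?V = ?V" using less.prems(2) by auto
    qed (use card big less.prems in auto)
    then show ?thesis by blast
  qed
qed

lemma norm_root_of_sign:
  fixes z :: complex
  assumes "z ^ c = of_real \<epsilon>" "\<bar>\<epsilon>\<bar> = 1" "c > 0"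
  shows "norm z = 1"
proof -
  have "norm z ^ c = norm (z ^ c)" by (simp add: norm_power)
  also have "\<dots> = 1 ^ c" using assms(1,2) by simp
  finally show ?thesis using power_eq_imp_eq_base[of "norm z" c 1] assms(3) by simp
qed

lemma inverse_unimodular: "norm z = 1 \<Longrightarrow> inverse z = cnj z"
  using complex_norm_square[of z] by (intro inverse_unique) simp

section \<open>Counting eigenvalues of the cycle\<close>

text \<open>
  On the unit circle \<open>z - 1 / z = 2 i Im z\<close>.
\<close>

lemma M_minus_cylinder_ge_roots:
  assumes "p \<ge> 1" "c \<ge> 3" "\<epsilon> * \<epsilon> = (1 :: real)" "finite L" "uminus ` L = L" "card L = p"
  shows "card {z. z ^ c = of_real \<epsilon> \<and> 2 * Im z \<in> L} \<le> M_minus (cylinder p c)"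
proof -
  let ?S = "{z. z ^ c = of_real \<epsilon> \<and> 2 * Im z \<in> L}"
  have \<epsilon>: "\<bar>\<epsilon>\<bar> = 1" using assms(3) by (metis abs_1 abs_mult_self_eq power2_eq_square real_sqrt_abs real_sqrt_one)
  \<comment> \<open>The root \<open>s = - i\<close> of \<open>\<sigma> = - 1\<close> makes \<open>- s y\<close> equal to \<open>i y\<close>, so that \<open>y = 2 Im z\<close>.\<close>
  obtain A where A: "matrix_pattern (cylinder p c) A" "transpose_mat A = (- 1) \<cdot>\<^sub>m A"
    "card ?S \<le> kernel_dim A"
  proof (rule cylinder_matrix_exists[OF assms(1,2) _ assms(3) _ assms(4-6), of "- 1" "- \<i>" ?S])
    fix z assume z: "z \<in> ?S"
    then have "inverse z = cnj z"
      using assms(2) \<epsilon> by (intro inverse_unimodular norm_root_of_sign) auto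
    then have "z + of_real (- 1) / z = - (- \<i> * of_real (2 * Im z))"
      by (simp add: divide_inverse complex_eq_iff)
    then show "\<exists>y\<in>L. z + of_real (- 1) / z = - (- \<i> * of_real y)" using z by blast
  qed auto
  have "(- 1) \<cdot>\<^sub>m A = - A" by (rule eq_matI) auto
  then have "A \<in> S_minus (cylinder p c)" using A by (simp add: S_minus_def)
  then show ?thesis using kernel_dim_le_M_minus A(3) le_trans by blast
qed

lemma card_preimage_ge:
  assumes "finite U" "finite L" "\<And>y. y \<in> L \<Longrightarrow> k \<le> card {z \<in> U. g z = y}"
  shows "k * card L \<le> card {z \<in> U. g z \<in> L}"
proof -
  have "k * card L = (\<Sum>y\<in>L. k)" by simp
  also have "\<dots> \<le> (\<Sum>y\<in>L. card {z \<in> U. g z = y})" by (rule sum_mono) (rule assms(3))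
  also have "\<dots> = card (\<Union>y\<in>L. {z \<in> U. g z = y})"
    using assms(1,2) by (intro card_UN_disjoint[symmetric]) auto
  also have "(\<Union>y\<in>L. {z \<in> U. g z = y}) = {z \<in> U. g z \<in> L}" by auto
  finally show ?thesis .
qed

lemma card_preimage_eq:
  assumes "finite U" "finite L" "\<And>y. y \<in> L \<Longrightarrow> card {z \<in> U. g z = y} = k"
  shows "card {z \<in> U. g z \<in> L} = k * card L"
proof -
  have "(\<Union>y\<in>L. {z \<in> U. g z = y}) = {z \<in> U. g z \<in> L}" by auto
  then have "card {z \<in> U. g z \<in> L} = card (\<Union>y\<in>L. {z \<in> U. g z = y})" by simp
  also have "\<dots> = (\<Sum>y\<in>L. card {z \<in> U. g z = y})"
    using assms(1,2) by (intro card_UN_disjoint) auto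
  finally show ?thesis using assms(3) by simp
qed

text \<open>
  The spectrum of the path is taken inside \<open>V\<close> or around \<open>V\<close>, depending on which is larger. This is
  possible exactly because \<open>p\<close> and \<open>card V\<close> have the same parity.
\<close>

lemma M_minus_cylinder_ge_fibres:
  fixes \<epsilon> :: real and c :: nat
  defines "U \<equiv> {z :: complex. z ^ c = of_real \<epsilon>}"
  assumes pc: "p \<ge> 1" "c \<ge> 3" "\<epsilon> * \<epsilon> = 1"
    and V: "finite V" "uminus ` V = V" "even (card V + p)"
    and fibre: "\<And>y. y \<in> V \<Longrightarrow> k \<le> card {z \<in> U. 2 * Im z = y}"
  shows "p \<le> card V \<Longrightarrow> k * p \<le> M_minus (cylinder p c)"
    and "card V \<le> p \<Longrightarrow> card {z \<in> U. 2 * Im z \<in> V} \<le> M_minus (cylinder p c)"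
proof -
  have \<epsilon>0: "\<epsilon> \<noteq> 0" using pc by auto
  have U: "finite U" unfolding U_def using finite_nth_roots pc by simp
  note bound = M_minus_cylinder_ge_roots[OF pc]
  {
    assume "p \<le> card V"
    then obtain L where L: "L \<subseteq> V" "uminus ` L = L" "card L = p"
      using symmetric_set_shrink[OF V(1,2) _ V(3)] by blast
    have fL: "finite L" using finite_subset[OF L(1) V(1)] .
    have "k * p \<le> card {z \<in> U. 2 * Im z \<in> L}"
      using card_preimage_ge[OF U fL, of k "\<lambda>z. 2 * Im z"] fibre L by auto
    also have "\<dots> \<le> M_minus (cylinder p c)" using bound[OF fL L(2,3)] by (simp add: U_def)
    finally show "k * p \<le> M_minus (cylinder p c)" .
  }
  {
    assume "card V \<le> p"
    then obtain L where L: "V \<subseteq> L" "finite L" "uminus ` L = L" "card L = p"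
      using symmetric_set_grow[OF V(1,2) _ V(3)] by blast
    have "card {z \<in> U. 2 * Im z \<in> V} \<le> card {z \<in> U. 2 * Im z \<in> L}"
      using U L(1) by (intro card_mono) auto
    also have "\<dots> \<le> M_minus (cylinder p c)" using bound[OF L(2-4)] by (simp add: U_def)
    finally show "card {z \<in> U. 2 * Im z \<in> V} \<le> M_minus (cylinder p c)" .
  }
qed

lemma unimodular_same_Im:
  assumes "norm z = 1" "norm w = 1" "Im z = Im w"
  shows "w = z \<or> w = - cnj z"
proof -
  have "(Re z)\<^sup>2 + (Im z)\<^sup>2 = 1" "(Re w)\<^sup>2 + (Im w)\<^sup>2 = 1"
    using assms by (simp_all add: cmod_def)
  then have "(Re w)\<^sup>2 = (Re z)\<^sup>2" using assms(3) by simp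
  then show ?thesis using assms(3) by (auto simp: power2_eq_iff complex_eq_iff)
qed

lemma unimodular_same_Re:
  assumes "norm z = 1" "norm w = 1" "Re z = Re w"
  shows "w = z \<or> w = cnj z"
proof -
  have "(Re z)\<^sup>2 + (Im z)\<^sup>2 = 1" "(Re w)\<^sup>2 + (Im w)\<^sup>2 = 1"
    using assms by (simp_all add: cmod_def)
  then have "(Im w)\<^sup>2 = (Im z)\<^sup>2" using assms(3) by simp
  then show ?thesis using assms(3) by (auto simp: power2_eq_iff complex_eq_iff)
qed

lemma cnj_root: "z ^ c = of_real \<epsilon> \<Longrightarrow> cnj z ^ c = of_real \<epsilon>"
  by (metis complex_cnj_complex_of_real complex_cnj_power)

lemma symmetric_Im_roots:
  "uminus ` (\<lambda>z. 2 * Im z) ` {z. z ^ c = of_real \<epsilon>} = (\<lambda>z. 2 * Im z) ` {z. z ^ c = of_real \<epsilon>}"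
    (is "uminus ` ?V = ?V")
proof -
  have "- y \<in> ?V" if y: "y \<in> ?V" for y
  proof -
    obtain z where z: "z ^ c = of_real \<epsilon>" "y = 2 * Im z" using y by blast
    then have "- y = 2 * Im (cnj z)" "cnj z \<in> {z. z ^ c = of_real \<epsilon>}" using cnj_root by auto
    then show ?thesis by blast
  qed
  then have sub: "uminus ` ?V \<subseteq> ?V" by blast
  from image_mono[OF this, of uminus] have "?V \<subseteq> uminus ` ?V" unfolding image_image by simp
  with sub show ?thesis by (rule equalityI)
qed

text \<open>
  Two roots of unity with the same imaginary part are equal or are \<open>z\<close> and \<open>- 1 / z\<close>, and for odd \<open>c\<close> the
  latter are not both roots of \<open>1\<close>. So the eigenvalues are distinct; \<open>0\<close> occurs among them, at \<open>z = 1\<close>, and is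
  left out when \<open>p\<close> is even.
\<close>

lemma M_minus_cylinder_odd_ge:
  assumes p: "p \<ge> 1" and c: "c \<ge> 3" "odd c"
  shows "min p (if even p then c - 1 else c) \<le> M_minus (cylinder p c)"
proof -
  define U where "U = {z :: complex. z ^ c = of_real 1}"
  let ?g = "\<lambda>z :: complex. 2 * Im z"
  have U: "finite U" "card U = c"
    unfolding U_def using finite_nth_roots[of c "of_real 1"] card_nth_roots[of "of_real 1" c] c by auto
  have nU: "norm z = 1" if "z \<in> U" for z using that norm_root_of_sign[of z c 1] c by (simp add: U_def)
  have inj: "inj_on ?g U"
  proof (rule inj_onI)
    fix z w assume zw: "z \<in> U" "w \<in> U" "?g z = ?g w"
    have "(- cnj z) ^ c \<noteq> 1"
      using zw(1) c cnj_root[of z c 1] by (simp add: U_def power_minus_odd)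
    then show "z = w" using unimodular_same_Im[OF nU nU, of z w] zw by (auto simp: U_def)
  qed
  define V where "V = (if even p then ?g ` U - {0} else ?g ` U)"
  have "1 \<in> U" by (simp add: U_def)
  then have "0 \<in> ?g ` U" by (force simp: image_iff)
  then have cardV: "card V = (if even p then c - 1 else c)"
    using U card_image[OF inj] by (simp add: V_def)
  have "uminus ` V = V"
    using symmetric_Im_roots[of c 1] by (auto simp: V_def U_def inj_image_mem_iff image_set_diff)
  moreover have "finite V" using U by (simp add: V_def)
  moreover have "even (card V + p)" using cardV c by auto
  moreover have "1 \<le> card {z \<in> U. ?g z = y}" if "y \<in> V" for y
  proof -
    have "{z \<in> U. ?g z = y} \<noteq> {}" using that by (auto simp: V_def split: if_splits)
    then show ?thesis using U(1) by (simp add: Suc_le_eq card_gt_0_iff)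
  qed
  ultimately have *: "p \<le> card V \<Longrightarrow> 1 * p \<le> M_minus (cylinder p c)"
    "card V \<le> p \<Longrightarrow> card {z \<in> U. ?g z \<in> V} \<le> M_minus (cylinder p c)"
    using M_minus_cylinder_ge_fibres[of p c 1 V 1] p c unfolding U_def by auto
  have "card V \<le> card (?g ` {z \<in> U. ?g z \<in> V})"
    using U by (intro card_mono) (auto simp: V_def)
  also have "\<dots> \<le> card {z \<in> U. ?g z \<in> V}" using U by (intro card_image_le) auto
  finally show ?thesis using * cardV by (cases "p \<le> card V") auto
qed

text \<open>
  For even \<open>c\<close> the roots come in pairs \<open>z\<close>, \<open>- 1 / z\<close> with the same imaginary part, apart from \<open>\<plusminus> i\<close>.
  With \<open>q = c / 2\<close>: if \<open>\<plusminus> i\<close> are not roots there are \<open>q\<close> values, all double. If they are, there are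
  \<open>q - 1\<close> double values and the simple ones \<open>\<plusminus> 2\<close>. The sign \<open>\<epsilon>\<close> selects the alternative in which the number
  of values has the parity of \<open>p\<close>. In the second one \<open>p \<noteq> q\<close>, so either \<open>p\<close> double values suffice for
  nullity \<open>2 p\<close> or all \<open>q + 1\<close> values fit into the spectrum of the path.
\<close>

lemma M_minus_cylinder_even_ge:
  assumes p: "p \<ge> 1" and c: "c \<ge> 3" "even c"
  shows "min (2 * p) c \<le> M_minus (cylinder p c)"
proof -
  obtain q where q: "c = 2 * q" using c(2) by blast
  define \<epsilon> :: real where "\<epsilon> = (if even (p + q) then - ((- 1) ^ q) else (- 1) ^ q)"
  have \<epsilon>: "\<epsilon> * \<epsilon> = 1" "\<bar>\<epsilon>\<bar> = 1" by (auto simp: \<epsilon>_def simp flip: power_add)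
  define U where "U = {z :: complex. z ^ c = of_real \<epsilon>}"
  let ?g = "\<lambda>z :: complex. 2 * Im z"
  have U: "finite U" "card U = c"
    unfolding U_def using finite_nth_roots[of c "of_real \<epsilon>"] card_nth_roots[of "of_real \<epsilon>" c] c \<epsilon> by auto
  have nU: "norm z = 1" if "z \<in> U" for z using that norm_root_of_sign[of z c \<epsilon>] c \<epsilon> by (simp add: U_def)
  have fibre: "card {w \<in> U. ?g w = ?g z} = 2" if "z \<in> U" "Re z \<noteq> 0" for z
  proof -
    have "- cnj z \<in> U" using that(1) c(2) cnj_root by (simp add: U_def)
    moreover have "w = z \<or> w = - cnj z" if "w \<in> U" "?g w = ?g z" for w
      using unimodular_same_Im[OF nU[OF \<open>z \<in> U\<close>] nU[OF that(1)]] that(2) by simp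
    ultimately have "{w \<in> U. ?g w = ?g z} = {z, - cnj z}" using that(1) by auto
    moreover have "z \<noteq> - cnj z" using that(2) by (simp add: complex_eq_iff)
    ultimately show ?thesis by simp
  qed
  have pm_i: "z = \<i> \<or> z = - \<i>" if "z \<in> U" "Re z = 0" for z
    using unimodular_same_Re[of \<i> z] nU[OF that(1)] that(2) by simp
  have i_pow: "\<i> ^ c = of_real ((- 1) ^ q)" "(- \<i>) ^ c = of_real ((- 1) ^ q)"
    by (simp_all add: q power_mult)
  let ?V = "?g ` U"
  have symV: "uminus ` ?V = ?V" unfolding U_def by (rule symmetric_Im_roots)
  note bound = M_minus_cylinder_ge_fibres[OF p c(1) \<epsilon>(1), folded U_def]
  show ?thesis
  proof (cases "even (p + q)")
    case True
    have "Re z \<noteq> 0" if "z \<in> U" for z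
      using pm_i[OF that] that i_pow True by (auto simp: U_def \<epsilon>_def)
    then have fib: "card {z \<in> U. ?g z = y} = 2" if "y \<in> ?V" for y using fibre that by auto
    have "card {z \<in> U. ?g z \<in> ?V} = 2 * card ?V"
      by (rule card_preimage_eq) (use U fib in auto)
    moreover have all: "{z \<in> U. ?g z \<in> ?V} = U" by auto
    ultimately have "card ?V = q" using U(2) q by simp
    then show ?thesis
      using bound[of ?V 2] symV U fib True q all by (cases "p \<le> q") (auto simp: add.commute)
  next
    case False
    have i_mem: "\<i> \<in> U" "- \<i> \<in> U" using i_pow False by (auto simp: U_def \<epsilon>_def)
    let ?W = "?V - {2, - 2}"
    have Re_nz: "Re z \<noteq> 0" if "z \<in> U" "?g z \<in> ?W" for z using pm_i[OF that(1)] that(2) by auto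
    have fib: "card {z \<in> U. ?g z = y} = 2" if "y \<in> ?W" for y
      using fibre Re_nz that by auto
    have "{z \<in> U. ?g z \<in> ?W} = U - {\<i>, - \<i>}"
    proof -
      have "z = \<i> \<or> z = - \<i>" if "z \<in> U" "?g z = 2 \<or> ?g z = - 2" for z
        using unimodular_same_Im[of \<i> z] unimodular_same_Im[of "- \<i>" z] nU[OF that(1)] that(2) by auto
      then show ?thesis by auto
    qed
    moreover have "card (U - {\<i>, - \<i>}) = c - 2"
      using i_mem U by (subst card_Diff_subset) (auto simp: complex_eq_iff)
    moreover have "card {z \<in> U. ?g z \<in> ?W} = 2 * card ?W"
      by (rule card_preimage_eq) (use U fib in auto)
    ultimately have cardW: "card ?W = q - 1" using q by simp
    have symW: "uminus ` ?W = ?W" using symV by (simp add: image_set_diff insert_commute)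
    have "2 \<in> ?V" "- 2 \<in> ?V" using i_mem by (force simp: image_iff)+
    then have "?V = insert 2 (insert (- 2) ?W)" by blast
    then have "card ?V = card (insert 2 (insert (- 2) ?W))" by (rule arg_cong)
    also have "\<dots> = card ?W + 2" using U by (subst card_insert_disjoint) auto
    finally have cardV: "card ?V = q + 1" using cardW q c by simp
    have pq: "p \<le> q - 1 \<or> q + 1 \<le> p" using False by presburger
    show ?thesis
    proof (cases "p \<le> q - 1")
      case True
      have "even (card ?W + p)" using cardW False q c by (cases q) auto
      then show ?thesis using bound(1)[of ?W 2] symW U fib cardW True by auto
    next
      case 2: False
      have "even (card ?V + p)" using cardV False by auto
      moreover have "{z \<in> U. ?g z \<in> ?V} = U" by auto
      \<comment> \<open>All roots count here, so the trivial lower bound \<open>0\<close> on the fibres suffices.\<close>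
      ultimately show ?thesis using bound(2)[of ?V 0] symV U cardV 2 pq by auto
    qed
  qed
qed

text \<open>
  On the unit circle \<open>z + 1 / z = 2 Re z\<close>. These values are double except at \<open>z = 1\<close>, so there are
  \<open>(c + 1) / 2\<close> of them. The set of their negatives must be added, since the spectrum of a path is
  symmetric. None of them is \<open>0\<close>, so the union has even cardinality, like \<open>p\<close>.
\<close>

lemma M_zero_cylinder_odd_ge:
  assumes c: "c \<ge> 3" "odd c" and p: "even p" "p \<ge> c"
  shows "c \<le> M_zero (cylinder p c)"
proof -
  define U where "U = {z :: complex. z ^ c = of_real 1}"
  let ?g = "\<lambda>z :: complex. 2 * Re z"
  have U: "finite U" "card U = c"
    unfolding U_def using finite_nth_roots[of c "of_real 1"] card_nth_roots[of "of_real 1" c] c by auto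
  have nU: "norm z = 1" if "z \<in> U" for z using that norm_root_of_sign[of z c 1] c by (simp add: U_def)
  let ?W = "?g ` U"
  let ?V = "?W \<union> uminus ` ?W"
  have Re_nz: "Re z \<noteq> 0" if z: "z \<in> U" for z
  proof
    assume "Re z = 0"
    then have i: "z = \<i> \<or> z = - \<i>" using unimodular_same_Re[of \<i> z] nU[OF z] by simp
    obtain k where "c = 2 * k + 1" using c(2) oddE by blast
    then have "z ^ c = (- 1) ^ k * z" using i by (auto simp: power_mult)
    moreover have "z ^ c = 1" using z by (simp add: U_def)
    ultimately show False using i by (cases "even k") (auto simp: complex_eq_iff)
  qed
  have fib: "card {z \<in> U. ?g z = y} = 2" if y: "y \<in> ?W - {2}" for y
  proof -
    obtain z where z: "z \<in> U" "y = ?g z" using y by blast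
    have "cnj z \<in> U" using z(1) cnj_root by (simp add: U_def del: of_real_1)
    moreover have "w = z \<or> w = cnj z" if "w \<in> U" "?g w = ?g z" for w
      using unimodular_same_Re[OF nU[OF z(1)] nU[OF that(1)]] that(2) by simp
    ultimately have "{w \<in> U. ?g w = ?g z} = {z, cnj z}" using z(1) by auto
    moreover have "z \<noteq> cnj z"
    proof
      assume "z = cnj z"
      then have "Im z = 0" by (simp add: complex_eq_iff)
      then have "z = 1 \<or> z = - 1" using unimodular_same_Im[of 1 z] nU[OF z(1)] by auto
      then show False using y z c(2) by (auto simp: U_def)
    qed
    ultimately show ?thesis using z by simp
  qed
  have "{z \<in> U. ?g z \<in> ?W - {2}} = U - {1}"
    using unimodular_same_Re[of 1] nU by auto
  then have "2 * card (?W - {2}) = c - 1"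
    using card_preimage_eq[of U "?W - {2}" ?g 2] U fib by (simp add: U_def)
  moreover have "card ?W \<le> card (?W - {2}) + 1"
    using U by (metis Suc_eq_plus1 card_Diff_singleton_if diff_le_self finite_imageI le_SucI le_diff_conv order_refl)
  ultimately have "2 * card ?W \<le> c + 1" using c by linarith
  moreover have "card ?V \<le> card ?W + card (uminus ` ?W)" by (rule card_Un_le)
  moreover have "card (uminus ` ?W) \<le> card ?W" using U by (intro card_image_le) auto
  moreover have "c + 1 \<le> p" using p c(2) by (cases "p = c") auto
  ultimately have small: "card ?V \<le> p" by linarith
  have sym: "uminus ` ?V = ?V" by (simp add: image_Un image_image Un_commute)
  have "0 \<notin> ?V" using Re_nz by auto
  then have "even (card ?V + p)" using card_symmetric_even[OF _ sym] U p(1) by simp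
  then obtain L where L: "?V \<subseteq> L" "finite L" "uminus ` L = L" "card L = p"
    using symmetric_set_grow[OF _ sym small] U by auto
  obtain A where A: "matrix_pattern (cylinder p c) A" "transpose_mat A = 1 \<cdot>\<^sub>m A"
    "\<And>i. i < card (pverts (cylinder p c)) \<Longrightarrow> A $$ (i, i) = 0" "card U \<le> kernel_dim A"
  proof (rule cylinder_matrix_exists[OF _ c(1) _ _ _ L(2-4), of 1 1 1 U])
    show "p \<ge> 1" using p c by simp
    fix z assume z: "z \<in> U"
    then have "inverse z = cnj z" by (intro inverse_unimodular nU)
    then have "z + of_real 1 / z = - (1 * of_real (- ?g z))"
      by (simp add: divide_inverse complex_eq_iff)
    moreover have "- ?g z \<in> L" using L(1) z by blast
    ultimately show "\<exists>y\<in>L. z + of_real 1 / z = - (1 * of_real y)" by blast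
  qed (auto simp: U_def)
  have "1 \<cdot>\<^sub>m A = A" by (rule eq_matI) auto
  then have "A \<in> S_zero (cylinder p c)" using A by (simp add: S_zero_def)
  then show ?thesis using kernel_dim_le_M_zero[of A] A(4) U(2) by fastforce
qed

section \<open>The cylinder\<close>

theorem corollary5p5:
  fixes p c :: nat
  assumes "p \<ge> 2" and "c \<ge> 3"
  shows "M_minus (cartesian_product (path_graph p) (cycle_graph c)) = eta p c \<and>
    int (mr_minus (cartesian_product (path_graph p) (cycle_graph c))) =
      int p * int c - int (eta p c) \<and>
    (odd c \<and> even p \<and> p \<ge> c \<longrightarrow>
      M_minus (cartesian_product (path_graph p) (cycle_graph c)) = c - 1 \<and>
      c - 1 < c \<and>
      c = Z_minus (cartesian_product (path_graph p) (cycle_graph c)) \<and>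
      M_zero (cartesian_product (path_graph p) (cycle_graph c)) = c)"
proof -
  have G: "pair_graph (cylinder p c)" using assms(2) by (rule pair_graph_cylinder)
  have fin: "finite (pverts (cylinder p c))" by (simp add: pverts_cylinder)
  have p1: "p \<ge> 1" using assms by simp
  have layer: "skew_zero_forcing_set (cylinder p c) ({0} \<times> {..<c})" "card ({0 :: nat} \<times> {..<c}) = c"
    using layer_forcing[OF p1] by auto
  have le_c: "M_minus (cylinder p c) \<le> c"
    using M_minus_le_forcing[OF G layer(1)] layer(2) by simp
  have le_2p: "M_minus (cylinder p c) \<le> 2 * p"
    using M_minus_le_forcing[OF G two_columns_forcing] assms(2) by (simp add: mult.commute)
  have le_p: "M_minus (cylinder p c) \<le> p" if "odd c"
    using M_minus_le_forcing[OF G zigzag_forcing[OF assms(2) that]]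
      card_image_le[of "{..<p}" "\<lambda>i. (i, i mod 2)"] by simp
  have parity: "M_minus (cylinder p c) \<noteq> c" if "odd c" "even p"
  proof
    obtain A where A: "A \<in> S_minus (cylinder p c)" "kernel_dim A = M_minus (cylinder p c)"
      by (rule M_minus_attained[OF G])
    assume M: "M_minus (cylinder p c) = c"
    have "even (p * c - c)"
      using skew_kernel_dim_parity[OF S_minus_carrier[OF A(1)]] A M
      by (simp add: card_pverts_cylinder S_minus_def)
    moreover have "c \<le> p * c" using p1 by simp
    ultimately show False using that by simp
  qed
  have eta: "M_minus (cylinder p c) = eta p c"
  proof (cases "even c")
    case True
    then show ?thesis using M_minus_cylinder_even_ge[OF p1 assms(2)] le_c le_2p by (simp add: eta_def)
  next
    case False
    note lower = M_minus_cylinder_odd_ge[OF p1 assms(2) False]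
    show ?thesis
    proof (cases "even p \<and> c \<le> p")
      case True
      then have "min p (c - 1) = c - 1" by linarith
      then show ?thesis using True lower parity False le_c assms by (simp add: eta_def)
    next
      case no: False
      have "min p (if even p then c - 1 else c) = min p c"
      proof (cases "c \<le> p")
        case True
        then show ?thesis using no by simp
      next
        case False
        then have "p \<le> c - 1" "p \<le> c" by linarith+
        then show ?thesis by (simp add: min_def)
      qed
      then show ?thesis using lower le_p False le_c no by (auto simp: eta_def)
    qed
  qed
  have "mr_minus (cylinder p c) + M_minus (cylinder p c) = p * c"
    using mr_minus_plus_M_minus[OF G] by (simp add: card_pverts_cylinder)
  then have "int (mr_minus (cylinder p c)) = int p * int c - int (eta p c)"
    unfolding eta by (metis add_diff_cancel_right' of_nat_add of_nat_mult)
  moreover have "M_minus (cylinder p c) = c - 1 \<and> c - 1 < c \<and> c = Z_minus (cylinder p c) \<and>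
      M_zero (cylinder p c) = c" if "odd c \<and> even p \<and> p \<ge> c"
  proof -
    have M0: "c \<le> M_zero (cylinder p c)" using M_zero_cylinder_odd_ge[OF assms(2)] that by blast
    moreover obtain B where "skew_zero_forcing_set (cylinder p c) B" "card B = Z_minus (cylinder p c)"
      by (rule Z_minus_attained[OF fin])
    then have "M_zero (cylinder p c) \<le> Z_minus (cylinder p c)" using M_zero_le_forcing[OF G] by metis
    moreover have "Z_minus (cylinder p c) \<le> c" using Z_minus_le[OF fin layer(1)] layer(2) by simp
    ultimately show ?thesis using eta that assms by (simp add: eta_def)
  qed
  ultimately show ?thesis using eta by blast
qed

end
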